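(* Let $d,k$ be positive integers. (a) For every $S \in \mathcal{S}^d(k)$ there exists an interior lattice point of $S$ all of whose barycentric coordinates with respect to $S$ are at least $\frac{1}{(d+1)(s_{d+1}-1)}$. (b) $p(d,k) \le \bigl(d(2d+1)(s_{2d+1}-1)\bigr)^d\, k$.
   Context: A lattice polytope in $\mathbb{R}^d$ is a polytope all of whose vertices lie in $\mathbb{Z}^d$. For positive integers $d,k$, $\mathcal{P}^d(k)$ denotes the family of all $d$-dimensional lattice polytopes in $\mathbb{R}^d$ having exactly $k$ interior lattice points (points of $\mathbb{Z}^d$ in the interior), $\mathcal{S}^d(k)$ the family of simplices in $\mathcal{P}^d(k)$, and $p(d,k) := \max\{\operatorname{vol}(P) : P \in \mathcal{P}^d(k)\}$, where $\operatorname{vol}$ is Lebesgue measure normalized so that $\operatorname{vol}([0,1]^d)=1$. For a $d$-simplex $S$ with vertices $v_1,\dots,v_{d+1}$, the barycentric coordinates of $x$ are the unique reals $\beta_1,\dots,\beta_{d+1}$ with $x=\sum_i \beta_i v_i$ and $\sum_i\beta_i=1$. The Sylvester sequence is defined by $s_1 := 2$ and $s_i := 1 + s_1 s_2 \cdots s_{i-1}$ for $i \ge 2$. *)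

theory Defs
  imports "HOL-Analysis.Analysis"
begin

definition lattice_point :: "real ^ 'n \<Rightarrow> bool" where
  "lattice_point x \<longleftrightarrow> (\<forall>i. x $ i \<in> \<int>)"

definition lattice_polytope :: "(real ^ 'n) set \<Rightarrow> bool" where
  "lattice_polytope P \<longleftrightarrow>
     (\<exists>V. finite V \<and> V \<noteq> {} \<and> (\<forall>v\<in>V. lattice_point v) \<and> P = convex hull V)"

definition num_interior_lattice_points :: "(real ^ 'n) set \<Rightarrow> nat" where
  "num_interior_lattice_points P = card {x \<in> interior P. lattice_point x}"

definition barycentric_coords :: "(real ^ 'n) set \<Rightarrow> (real ^ 'n \<Rightarrow> real) \<Rightarrow> real ^ 'n \<Rightarrow> bool" where
  "barycentric_coords V \<beta> x \<longleftrightarrow> (\<Sum>v\<in>V. \<beta> v) = 1 \<and> (\<Sum>v\<in>V. \<beta> v *\<^sub>R v) = x"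

text \<open>Sylvester sequence: sylv_seq n = [s_1, ..., s_n], s_i = 1 + s_1 ... s_{i-1}.\<close>
primrec sylv_seq :: "nat \<Rightarrow> nat list" where
  "sylv_seq 0 = []"
| "sylv_seq (Suc n) = sylv_seq n @ [1 + prod_list (sylv_seq n)]"

definition sylvester :: "nat \<Rightarrow> nat" where
  "sylvester i = sylv_seq i ! (i - 1)"

end

theory Submission
  imports Defs
begin

text \<open>
  Let \<open>v 1, ..., v N\<close> be lattice points for which some convex combination with positive coefficients
  is a lattice point. Among all convex combinations \<open>x = (\<Sum>i. \<beta> i v i)\<close> that are lattice points
  choose one whose smallest coefficient \<open>m\<close> is as large as possible, and order \<open>\<beta>\<close> decreasingly. If
  \<open>(\<beta> 1 - m) ... (\<beta> j - m) > \<beta> (j+1) + ... + \<beta> N\<close>, then Minkowski's theorem on linear forms gives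
  integers \<open>t > 0\<close> and \<open>p 1 + ... + p j = t\<close> with \<open>\<bar>t \<beta> i - p i\<bar> < \<beta> i - m\<close>, and the lattice point
  \<open>(1 + t) x - (\<Sum>i\<le>j. p i v i)\<close> has all its coefficients larger than \<open>m\<close>, a contradiction. These
  product-sum inequalities force \<open>(\<beta> 1 - m) + ... + (\<beta> (N-1) - m)\<close> to be at most
  \<open>1/s_1 + ... + 1/s_(N-1) = 1 - 1/(s_N - 1)\<close>, that is, \<open>N m \<ge> 1/(s_N - 1)\<close>. For the vertices
  of a simplex this is (a).

  For (b), let \<open>T\<close> be a simplex of maximal volume spanned by vertices of \<open>P\<close>, so that \<open>P\<close> lies in a
  translate of \<open>- d T\<close>. An interior lattice point of \<open>P\<close> is a positive combination of the \<open>d + 1\<close>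
  vertices of \<open>T\<close> and \<open>d\<close> further vertices of \<open>P\<close>. The bound above with \<open>N = 2 d + 1\<close> yields a
  lattice point \<open>x\<close> with \<open>x + m (T - T) \<subseteq> P\<close>, and Blichfeldt's theorem applied to \<open>m T\<close> shows
  \<open>m ^ d vol T \<le> k\<close>.
\<close>

section \<open>Sylvester's sequence and product-sum inequalities\<close>

lemma sylvester_Suc: "sylvester (Suc n) = 1 + prod_list (sylv_seq n)"
proof -
  have "length (sylv_seq n) = n" for n
    by (induction n) auto
  then show ?thesis
    by (simp add: sylvester_def nth_append)
qed

lemma prod_sylvester: "(\<Prod>i<n. real (sylvester (Suc i))) = real (sylvester (Suc n)) - 1"
proof -
  have "prod_list (sylv_seq n) = (\<Prod>i<n. sylvester (Suc i))"
    by (induction n) (auto simp: sylvester_Suc)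
  then show ?thesis
    by (simp add: sylvester_Suc)
qed

lemma sylvester_gt_1: "real (sylvester (Suc n)) > 1"
proof (induction n rule: less_induct)
  case (less n)
  have "(\<Prod>i<n. real (sylvester (Suc i))) > 0"
    using less by (intro prod_pos) force
  then show ?case
    by (simp add: prod_sylvester)
qed

text \<open>The sum telescopes: \<open>1 / s = 1 / (s - 1) - 1 / (s * (s - 1))\<close>, and
  \<open>s * (s - 1)\<close> is the next Sylvester number minus one.\<close>

lemma sum_inverse_sylvester:
  "(\<Sum>i<n. 1 / real (sylvester (Suc i))) = 1 - 1 / (real (sylvester (Suc n)) - 1)"
proof (induction n)
  case 0
  show ?case by (simp add: sylvester_Suc)
next
  case (Suc n)
  let ?s = "real (sylvester (Suc n))"
  have "real (sylvester (Suc (Suc n))) - 1 = ?s * (?s - 1)"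
    using prod_sylvester[of "Suc n"] prod_sylvester[of n] by (simp add: mult.commute)
  moreover have "1 / ?s = 1 / (?s - 1) - 1 / (?s * (?s - 1))"
    using sylvester_gt_1[of n] by (simp add: divide_simps)
  ultimately show ?case
    using Suc by simp
qed

text \<open>With \<open>y i / x i \<le> exp ((y i - x i) / x i)\<close>, the claim reduces to negativity of the sum of
  the exponents, which is Abel summation against the increasing sequence \<open>1 / x i\<close>.\<close>
lemma prod_less_of_partial_sums:
  fixes x y :: "nat \<Rightarrow> real"
  assumes dec: "\<And>i j. i \<le> j \<Longrightarrow> j \<le> n \<Longrightarrow> x j \<le> x i"
    and pos: "\<And>i. i \<le> n \<Longrightarrow> 0 < x i" and y: "\<And>i. i \<le> n \<Longrightarrow> 0 \<le> y i"
    and le: "\<And>j. j \<le> n \<Longrightarrow> (\<Sum>i<j. x i) \<le> (\<Sum>i<j. y i)"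
    and less: "(\<Sum>i<Suc n. y i) < (\<Sum>i<Suc n. x i)"
  shows "(\<Prod>i<Suc n. y i) < (\<Prod>i<Suc n. x i)"
proof -
  define D where "D j = (\<Sum>i<j. y i) - (\<Sum>i<j. x i)" for j
  have abel: "(\<Sum>i<Suc j. (y i - x i) / x i) \<le> D (Suc j) / x j" if "j \<le> n" for j
    using that
  proof (induction j)
    case 0
    then show ?case by (simp add: D_def)
  next
    case (Suc j)
    have "D (Suc j) / x j \<le> D (Suc j) / x (Suc j)"
      using Suc.prems le[of "Suc j"] pos[of j] pos[of "Suc j"] dec[of j "Suc j"]
      by (intro divide_left_mono) (auto simp: D_def)
    moreover have "D (Suc (Suc j)) = D (Suc j) + (y (Suc j) - x (Suc j))"
      by (simp add: D_def)
    ultimately show ?case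
      using Suc.IH Suc.prems by (simp add: add_divide_distrib)
  qed
  have "D (Suc n) / x n < 0"
    using less pos[of n] by (simp add: D_def divide_neg_pos)
  then have neg: "(\<Sum>i<Suc n. (y i - x i) / x i) < 0"
    using abel[of n] by simp
  have "(\<Prod>i<Suc n. y i / x i) \<le> (\<Prod>i<Suc n. exp ((y i - x i) / x i))"
  proof (rule prod_mono, safe)
    fix i assume "i < Suc n"
    then have "0 < x i" "0 \<le> y i" using pos y by auto
    then show "0 \<le> y i / x i" by simp
    have "y i / x i = 1 + (y i - x i) / x i"
      using \<open>0 < x i\<close> by (simp add: field_simps)
    then show "y i / x i \<le> exp ((y i - x i) / x i)"
      using exp_ge_add_one_self by simp
  qed
  also have "\<dots> = exp (\<Sum>i<Suc n. (y i - x i) / x i)"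
    by (simp only: exp_sum finite_lessThan)
  also have "\<dots> < 1"
    using neg by simp
  finally have "(\<Prod>i<Suc n. y i) / (\<Prod>i<Suc n. x i) < 1"
    by (simp only: prod_dividef)
  moreover have "(\<Prod>i<Suc n. x i) > 0"
    using pos by (intro prod_pos) auto
  ultimately show ?thesis
    by (simp only: divide_less_eq_1_pos)
qed

text \<open>The Sylvester reciprocals \<open>y\<close> satisfy every product-sum constraint with
  equality. If the sum of \<open>x\<close> exceeded theirs while no shorter partial sum does, the
  product of \<open>x\<close> would exceed that of \<open>y\<close>, which is 1 minus the sum of
  \<open>y\<close> and hence more than 1 minus the sum of \<open>x\<close>.\<close>

lemma sum_le_of_prod_le:
  fixes x :: "nat \<Rightarrow> real"
  assumes dec: "\<And>i j. i \<le> j \<Longrightarrow> j < n \<Longrightarrow> x j \<le> x i"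
    and nn: "\<And>i. i < n \<Longrightarrow> 0 \<le> x i"
    and ps: "\<And>j. j \<le> n \<Longrightarrow> (\<Prod>i<j. x i) \<le> 1 - (\<Sum>i<j. x i)"
  shows "(\<Sum>i<n. x i) \<le> 1 - 1 / (real (sylvester (Suc n)) - 1)"
  using assms
proof (induction n rule: less_induct)
  case (less n)
  define y where "y i = 1 / real (sylvester (Suc i))" for i
  have ypos: "y i > 0" for i
    using sylvester_gt_1[of i] by (simp add: y_def)
  have le: "(\<Sum>i<j. x i) \<le> (\<Sum>i<j. y i)" if "j < n" for j
    unfolding y_def sum_inverse_sylvester using that less.prems
    by (intro less.IH) auto
  show ?case
  proof (rule ccontr)
    assume neg: "\<not> ?thesis"
    then have gt: "(\<Sum>i<n. y i) < (\<Sum>i<n. x i)"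
      unfolding y_def sum_inverse_sylvester by simp
    then obtain m where n: "n = Suc m"
      by (cases n) auto
    \<comment> \<open>The product comparison needs positive entries. As \<open>x\<close> is
      decreasing, only the last one matters; if it were not positive, the excess would already occur
      in the partial sum up to \<open>m\<close>.\<close>
    have "x m > 0"
    proof (rule ccontr)
      assume "\<not> x m > 0"
      with gt le[of m] ypos[of m] show False by (simp add: n)
    qed
    then have "(\<Prod>i<Suc m. y i) < (\<Prod>i<Suc m. x i)"
      using less.prems(1) gt le ypos unfolding n
      by (intro prod_less_of_partial_sums) (force intro: less_le_trans less_imp_le)+
    also have "\<dots> \<le> 1 - (\<Sum>i<Suc m. x i)"
      using less.prems(3)[of n] by (simp add: n)
    also have "\<dots> < 1 - (\<Sum>i<Suc m. y i)"
      using gt by (simp add: n)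
    also have "\<dots> = (\<Prod>i<Suc m. y i)"
      using sum_inverse_sylvester[of "Suc m"] prod_sylvester[of "Suc m"]
      by (simp add: y_def prod_dividef)
    finally show False by simp
  qed
qed

section \<open>The theorems of Blichfeldt and Minkowski\<close>

lemma ex_lattice_translate_in_unit_cube:
  fixes x :: "real^'n"
  shows "\<exists>z. lattice_point z \<and> x - z \<in> cbox 0 1"
proof (intro exI conjI)
  let ?z = "\<chi> i. of_int \<lfloor>x $ i\<rfloor> :: real^'n"
  show "lattice_point ?z"
    by (simp add: lattice_point_def)
  show "x - ?z \<in> cbox 0 1"
    unfolding mem_box_cart by (auto, linarith)
qed

lemma finite_lattice_points_bounded:
  fixes B :: "(real^'n) set"
  assumes "bounded B"
  shows "finite {z \<in> B. lattice_point z}"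
proof -
  obtain r where r: "\<And>x. x \<in> B \<Longrightarrow> norm x \<le> r"
    using assms bounded_iff by blast
  let ?F = "{f :: 'n \<Rightarrow> int. \<forall>i. f i \<in> {- \<lceil>r\<rceil>..\<lceil>r\<rceil>}}"
  have "finite ?F"
    using finite_PiE[of "UNIV :: 'n set" "\<lambda>_. {- \<lceil>r\<rceil>..\<lceil>r\<rceil>}"]
    by (simp add: PiE_def Pi_def)
  moreover have "{z \<in> B. lattice_point z} \<subseteq> (\<lambda>f. \<chi> i. of_int (f i)) ` ?F"
  proof safe
    fix z assume z: "z \<in> B" "lattice_point z"
    show "z \<in> (\<lambda>f. \<chi> i. of_int (f i)) ` ?F"
    proof (rule image_eqI)
      have fl: "of_int \<lfloor>z $ i\<rfloor> = z $ i" for i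
        using z(2) by (simp add: lattice_point_def)
      then show "z = (\<chi> i. of_int \<lfloor>z $ i\<rfloor>)"
        unfolding vec_eq_iff vec_lambda_beta by metis
      have "\<bar>z $ i\<bar> \<le> r" for i
        using component_le_norm_cart[of z i] r[OF z(1)] by linarith
      then have "\<bar>of_int \<lfloor>z $ i\<rfloor>\<bar> \<le> (of_int \<lceil>r\<rceil> :: real)" for i
        unfolding fl using le_of_int_ceiling order_trans by blast
      then have "\<lfloor>z $ i\<rfloor> \<in> {- \<lceil>r\<rceil>..\<lceil>r\<rceil>}" for i
        by (simp only: of_int_abs[symmetric] of_int_le_iff) (simp add: abs_le_iff minus_le_iff)
      then show "(\<lambda>i. \<lfloor>z $ i\<rfloor>) \<in> ?F"
        by simp
    qed
  qed
  ultimately show ?thesis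
    by (meson finite_imageI finite_subset)
qed

text \<open>Cut \<open>A\<close> along the lattice translates of the unit cube \<open>C\<close> and
  move all pieces \<open>S z\<close> into \<open>C\<close>. Their total measure exceeds
  \<open>k\<close> times that of \<open>C\<close>, so some point lies in at least
  \<open>k + 1\<close> pieces.\<close>

theorem blichfeldt:
  fixes A :: "(real^'n) set"
  assumes A: "A \<in> lmeasurable" "bounded A" and k: "real k < measure lebesgue A"
  obtains x Z where "finite Z" "card Z = Suc k" "\<And>z. z \<in> Z \<Longrightarrow> lattice_point z"
    "\<And>z. z \<in> Z \<Longrightarrow> x + z \<in> A"
proof -
  define C :: "(real^'n) set" where "C = cbox 0 1"
  \<comment> \<open>These are exactly the lattice points whose piece \<open>S z\<close> is
    nonempty.\<close>
  define Z where "Z = {z \<in> {a - c |a c. a \<in> A \<and> c \<in> C}. lattice_point z}"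
  define S where "S z = C \<inter> (+) (- z) ` A" for z
  have "bounded {a - c |a c. a \<in> A \<and> c \<in> C}"
    by (rule bounded_subset[OF bounded_minus[OF A(2), of C]]) (auto simp: C_def)
  then have finZ: "finite Z"
    unfolding Z_def by (rule finite_lattice_points_bounded)
  have S: "S z \<in> lmeasurable" for z
    unfolding S_def C_def
    by (intro fmeasurable.Int measurable_translation A) auto
  have int: "integrable lebesgue (indicat_real (S z))" for z
    using S[of z] by (simp add: lmeasurable_iff_integrable)
  have "A \<subseteq> (\<Union>z\<in>Z. (+) z ` S z)"
  proof
    fix a assume a: "a \<in> A"
    obtain z where z: "lattice_point z" "a - z \<in> C"
      using ex_lattice_translate_in_unit_cube C_def by blast
    then have "z \<in> Z"
      using a unfolding Z_def by (force intro: exI[of _ a] exI[of _ "a - z"])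
    moreover have "a \<in> (+) z ` S z"
      using a z by (auto simp: S_def image_iff intro!: bexI[of _ "a - z"])
    ultimately show "a \<in> (\<Union>z\<in>Z. (+) z ` S z)" by blast
  qed
  then have "measure lebesgue A \<le> measure lebesgue (\<Union>z\<in>Z. (+) z ` S z)"
    using A finZ S
    by (intro measure_mono_fmeasurable fmeasurable.finite_UN) (auto intro: measurable_translation)
  also have "\<dots> \<le> (\<Sum>z\<in>Z. measure lebesgue ((+) z ` S z))"
    using finZ S by (intro measure_UNION_le fmeasurableD measurable_translation)
  also have "\<dots> = (\<integral>x. (\<Sum>z\<in>Z. indicat_real (S z) x) \<partial>lebesgue)"
    using int by (simp add: measure_translation)
  finally have less: "real k < (\<integral>x. (\<Sum>z\<in>Z. indicat_real (S z) x) \<partial>lebesgue)"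
    using k by simp
  have "\<exists>x. Suc k \<le> card {z \<in> Z. x \<in> S z}"
  proof (rule ccontr)
    assume "\<not> ?thesis"
    then have few: "card {z \<in> Z. x \<in> S z} \<le> k" for x
      by (meson not_less_eq_eq)
    have "(\<Sum>z\<in>Z. indicat_real (S z) x) \<le> real k * indicat_real C x" for x
    proof (cases "x \<in> C")
      case True
      have "(\<Sum>z\<in>Z. indicat_real (S z) x) = card {z \<in> Z. x \<in> S z}"
        using finZ by (simp add: indicator_def sum.If_cases Int_def)
      then show ?thesis using few[of x] True by simp
    next
      case False
      then show ?thesis by (simp add: S_def)
    qed
    then have "(\<integral>x. (\<Sum>z\<in>Z. indicat_real (S z) x) \<partial>lebesgue) \<le> (\<integral>x. real k * indicat_real C x \<partial>lebesgue)"
      using int by (intro integral_mono) (auto simp: C_def lmeasurable_iff_integrable[symmetric])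
    also have "\<dots> = real k"
      by (simp add: C_def content_cbox_if_cart interval_eq_empty_cart)
    finally show False using less by simp
  qed
  then obtain x where x: "Suc k \<le> card {z \<in> Z. x \<in> S z}" ..
  obtain Z' where Z': "Z' \<subseteq> {z \<in> Z. x \<in> S z}" "card Z' = Suc k" "finite Z'"
    using obtain_subset_with_card_n[OF x] by blast
  show thesis
  proof (rule that[OF Z'(3,2)])
    show "lattice_point z" if "z \<in> Z'" for z
      using that Z'(1) by (auto simp: Z_def)
    show "x + z \<in> A" if "z \<in> Z'" for z
      using that Z'(1) by (auto simp: S_def)
  qed
qed

section \<open>Determinants and Minkowski's theorem on linear forms\<close>

text \<open>Rows of this matrix, in variables \<open>t\<close> (at \<open>i0\<close>) and \<open>p i\<close> (at \<open>i \<in> J - {i0}\<close>): the forms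
  \<open>t * b i - p i\<close> for \<open>i \<in> J\<close>, with \<open>p i0\<close> eliminated by \<open>(\<Sum>i\<in>J. p i) = t\<close>. Outside \<open>J\<close> the
  matrix is padded by the identity so that its size does not depend on \<open>J\<close>.\<close>
definition form_matrix :: "'m set \<Rightarrow> 'm \<Rightarrow> ('m \<Rightarrow> real) \<Rightarrow> real^'m^'m" where
  "form_matrix J i0 b = (\<chi> i j. if i = i0 then (if j = i0 then b i0 - 1 else if j \<in> J then 1 else 0)
     else if i \<in> J then (if j = i0 then b i else if j = i then -1 else 0)
     else (if j = i then 1 else 0))"

text \<open>Adding the rows in \<open>J - {i0}\<close> to row \<open>i0\<close> leaves a single
  entry in it (\<open>M1\<close>); multiples of the columns in \<open>J - {i0}\<close> then clear
  the rest of column \<open>i0\<close> (\<open>M2\<close>, diagonal). The column operations are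
  carried out as row operations on the transpose.\<close>

lemma abs_det_form_matrix:
  fixes b :: "'m::finite \<Rightarrow> real"
  assumes i0: "i0 \<in> J"
  shows "\<bar>det (form_matrix J i0 b)\<bar> = \<bar>1 - (\<Sum>i\<in>J. b i)\<bar>"
proof -
  let ?M = "form_matrix J i0 b"
  have J: "(\<Sum>i\<in>J. f i) = f i0 + (\<Sum>i\<in>J - {i0}. f i)" for f :: "'m \<Rightarrow> real"
    using i0 by (simp add: sum.remove)
  define M1 :: "real^'m^'m" where "M1 = (\<chi> i j.
     if i = i0 then (if j = i0 then (\<Sum>i\<in>J. b i) - 1 else 0)
     else if i \<in> J then (if j = i0 then b i else if j = i then -1 else 0)
     else (if j = i then 1 else 0))"
  define M2 :: "real^'m^'m" where "M2 = (\<chi> i j. if i = j then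
     (if i = i0 then (\<Sum>i\<in>J. b i) - 1 else if i \<in> J then -1 else 1) else 0)"
  define x1 where "x1 = (\<Sum>i\<in>J - {i0}. row i ?M)"
  define x2 where "x2 = (\<Sum>i\<in>J - {i0}. b i *s row i (transpose M1))"
  have "x1 \<in> vec.span {row j ?M |j. j \<noteq> i0}"
    unfolding x1_def by (intro vec.span_sum vec.span_base) auto
  then have "det (\<chi> k. if k = i0 then row i0 ?M + x1 else row k ?M) = det ?M"
    by (rule det_row_span)
  moreover have "x1 $ j = (if j = i0 then \<Sum>i\<in>J - {i0}. b i else if j \<in> J then -1 else 0)" for j
  proof -
    have "x1 $ j = (\<Sum>i\<in>J - {i0}. if j = i0 then b i else if j = i then -1 else 0)"
      unfolding x1_def sum_component by (intro sum.cong) (auto simp: row_def form_matrix_def)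
    also have "\<dots> = (if j = i0 then \<Sum>i\<in>J - {i0}. b i else if j \<in> J then -1 else 0)"
      by (cases "j = i0") simp_all
    finally show ?thesis .
  qed
  then have "(\<chi> k. if k = i0 then row i0 ?M + x1 else row k ?M) = M1"
    using J[of b] by (simp add: vec_eq_iff M1_def form_matrix_def row_def)
  ultimately have d1: "det M1 = det ?M" by simp
  have "x2 \<in> vec.span {row j (transpose M1) |j. j \<noteq> i0}"
    unfolding x2_def by (intro vec.span_sum vec.span_scale vec.span_base) auto
  then have "det (\<chi> k. if k = i0 then row i0 (transpose M1) + x2 else row k (transpose M1)) = det (transpose M1)"
    by (rule det_row_span)
  moreover have "x2 $ j = (if j \<in> J - {i0} then - b j else 0)" for j
  proof -
    have "x2 $ j = (\<Sum>i\<in>J - {i0}. if j = i then - b j else 0)"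
      unfolding x2_def sum_component
      by (intro sum.cong) (auto simp: row_def transpose_def M1_def)
    then show ?thesis by simp
  qed
  then have "(\<chi> k. if k = i0 then row i0 (transpose M1) + x2 else row k (transpose M1)) = M2"
    by (auto simp: vec_eq_iff M1_def M2_def row_def transpose_def)
  ultimately have d2: "det M2 = det M1" by simp
  have "det M2 = (\<Prod>i\<in>UNIV. M2 $ i $ i)"
    by (rule det_diagonal) (simp add: M2_def)
  also have "\<dots> = ((\<Sum>i\<in>J. b i) - 1) * (\<Prod>i\<in>UNIV - {i0}. if i \<in> J then -1 else 1)"
    by (subst prod.remove[of UNIV i0]) (auto simp: M2_def intro!: prod.cong)
  finally have "\<bar>det M2\<bar> = \<bar>(\<Sum>i\<in>J. b i) - 1\<bar> * (\<Prod>i\<in>UNIV - {i0}. \<bar>if i \<in> J then -1 else 1\<bar>)"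
    by (simp add: abs_mult abs_prod)
  also have "(\<Prod>i\<in>UNIV - {i0}. \<bar>if i \<in> J then -1 else (1::real)\<bar>) = 1"
    by (intro prod.neutral) auto
  finally show ?thesis using d1 d2 by (simp add: abs_minus_commute)
qed

text \<open>The preimage \<open>A\<close> of an open box with side lengths \<open>a i\<close> has
  volume greater than 1, so Blichfeldt's theorem with \<open>k = 1\<close> puts two points of
  \<open>A\<close> at a nonzero lattice distance.\<close>

lemma minkowski_linear_forms:
  fixes M :: "real^'m::{finite,wellorder}^'m::{finite,wellorder}" and a :: "'m \<Rightarrow> real"
  assumes det: "det M \<noteq> 0" and a: "\<And>i. 0 < a i" and less: "\<bar>det M\<bar> < (\<Prod>i\<in>UNIV. a i)"
  obtains z where "lattice_point z" "z \<noteq> 0" "\<And>i. \<bar>(M *v z) $ i\<bar> < a i"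
proof -
  define f where "f = (\<lambda>z. M *v z)"
  \<comment> \<open>With half-widths \<open>a i / 2\<close>, two points of the box differ by less
    than \<open>a i\<close> in each coordinate.\<close>
  define Q where "Q = box (\<chi> i. - a i / 2) (\<chi> i. a i / 2)"
  have lin: "linear f" by (simp add: f_def)
  obtain N where N: "M ** N = mat 1"
    using det by (metis invertible_det_nz invertible_right_inverse)
  define A where "A = (\<lambda>z. N *v z) ` Q"
  have fA: "f ` A = Q"
    by (simp add: A_def f_def image_image matrix_vector_mul_assoc N)
  have Q: "Q \<in> lmeasurable" "bounded Q" by (auto simp: Q_def)
  have A: "A \<in> lmeasurable"
    unfolding A_def by (rule measurable_linear_image[OF matrix_vector_mul_linear Q(1)])
  have bA: "bounded A"
    unfolding A_def by (rule bounded_linear_image[OF Q(2) matrix_vector_mul_bounded_linear])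
  have "measure lebesgue Q = \<bar>det M\<bar> * measure lebesgue A"
    using measure_linear_image[OF lin A] fA by (simp add: f_def)
  moreover have "measure lebesgue Q = (\<Prod>i\<in>UNIV. a i)"
  proof -
    have "measure lebesgue Q = measure lborel (cbox (\<chi> i. - a i / 2) (\<chi> i. a i / 2))"
      by (simp add: Q_def measure_lborel_box_eq measure_lborel_cbox_eq)
    also have "\<dots> = (\<Prod>i\<in>UNIV. a i)"
      using a by (auto simp: content_cbox_if_cart interval_eq_empty_cart dest: less_asym)
    finally show ?thesis .
  qed
  ultimately have "real 1 < measure lebesgue A"
    using less det by (simp add: field_simps)
  then obtain x Z where Z: "finite Z" "card Z = Suc 1" "\<And>z. z \<in> Z \<Longrightarrow> lattice_point z"
    "\<And>z. z \<in> Z \<Longrightarrow> x + z \<in> A"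
    using blichfeldt[OF A bA] by metis
  then obtain y z where yz: "Z = {y, z}" "y \<noteq> z"
    by (metis card_2_iff One_nat_def Suc_1)
  show thesis
  proof (rule that[of "y - z"])
    show "lattice_point (y - z)" using Z(3)[of y] Z(3)[of z] yz by (simp add: lattice_point_def)
    show "y - z \<noteq> 0" using yz by simp
    fix i
    have "f (x + y) \<in> Q" "f (x + z) \<in> Q" using Z(4) yz fA by blast+
    then have "\<bar>f (x + y) $ i - f (x + z) $ i\<bar> < a i"
      by (auto simp: Q_def mem_box_cart abs_less_iff dest!: spec[of _ i])
    moreover have "f (x + y) $ i - f (x + z) $ i = (M *v (y - z)) $ i"
      by (simp add: f_def matrix_vector_mult_diff_distrib matrix_vector_right_distrib)
    ultimately show "\<bar>(M *v (y - z)) $ i\<bar> < a i" by simp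
  qed
qed

text \<open>The numerators \<open>p i\<close> must add up to the common denominator \<open>t\<close>
  itself: subtracting them from \<open>1 + t\<close> times a coefficient vector of sum 1 then gives
  sum 1 again.\<close>

lemma simultaneous_approximation:
  fixes b a :: "'m::{finite,wellorder} \<Rightarrow> real"
  assumes b: "(\<Sum>i\<in>J. b i) < 1"
    and a: "\<And>i. i \<in> J \<Longrightarrow> 0 < a i" "\<And>i. i \<in> J \<Longrightarrow> a i < 1"
    and J: "J \<noteq> {}" and less: "1 - (\<Sum>i\<in>J. b i) < (\<Prod>i\<in>J. a i)"
  obtains t :: nat and p :: "'m \<Rightarrow> int" where "t > 0" "(\<Sum>i\<in>J. p i) = int t"
    "\<And>i. i \<in> J \<Longrightarrow> \<bar>real t * b i - of_int (p i)\<bar> < a i"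
proof -
  obtain i0 where i0: "i0 \<in> J" using J by blast
  let ?M = "form_matrix J i0 b"
  \<comment> \<open>Outside \<open>J\<close> the form is the coordinate itself, and an integer of
    absolute value below 1 is 0.\<close>
  define a' where "a' i = (if i \<in> J then a i else 1)" for i
  have "det ?M \<noteq> 0" using abs_det_form_matrix[OF i0, of b] b by auto
  moreover have "0 < a' i" for i using a by (simp add: a'_def)
  moreover have "(\<Prod>i\<in>UNIV. a' i) = (\<Prod>i\<in>J. a i)"
    by (simp add: a'_def prod.If_cases)
  then have "\<bar>det ?M\<bar> < (\<Prod>i\<in>UNIV. a' i)"
    using abs_det_form_matrix[OF i0, of b] b less by simp
  ultimately obtain z where z: "lattice_point z" "z \<noteq> 0" "\<And>i. \<bar>(?M *v z) $ i\<bar> < a' i"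
    using minkowski_linear_forms by metis
  have fl: "of_int \<lfloor>z $ i\<rfloor> = z $ i" for i
    using z(1) by (simp add: lattice_point_def)
  define t where "t = \<lfloor>z $ i0\<rfloor>"
  define p where "p i = (if i = i0 then t - (\<Sum>j\<in>J - {i0}. \<lfloor>z $ j\<rfloor>) else \<lfloor>z $ i\<rfloor>)" for i
  have sum_p: "(\<Sum>i\<in>J. p i) = t"
    using i0 by (simp add: sum.remove p_def)
  have Mz: "(?M *v z) $ i = of_int t * b i - of_int (p i)" if "i \<in> J" for i
  proof (cases "i = i0")
    case True
    have "(\<Sum>j\<in>UNIV. ?M $ i0 $ j * z $ j) = (b i0 - 1) * z $ i0 + (\<Sum>j\<in>UNIV - {i0}. (if j \<in> J then z $ j else 0))"
      by (subst sum.remove[of _ i0]) (auto simp: form_matrix_def intro!: sum.cong split: if_splits)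
    also have "(\<Sum>j\<in>UNIV - {i0}. (if j \<in> J then z $ j else 0)) = (\<Sum>j\<in>J - {i0}. z $ j)"
      by (subst sum.inter_filter[symmetric]) (auto intro!: sum.cong)
    finally show ?thesis
      using True by (simp add: matrix_vector_mult_def p_def t_def fl algebra_simps)
  next
    case False
    have "(\<Sum>j\<in>UNIV. ?M $ i $ j * z $ j) = (\<Sum>j\<in>UNIV. (if j = i0 then b i * z $ i0 else 0) + (if j = i then - z $ i else 0))"
      using False that by (intro sum.cong) (auto simp: form_matrix_def)
    also have "\<dots> = b i * z $ i0 - z $ i"
      by (simp add: sum.distrib)
    finally show ?thesis
      using False by (simp add: matrix_vector_mult_def p_def t_def fl algebra_simps)
  qed
  have bd: "\<bar>of_int t * b i - of_int (p i)\<bar> < a i" if "i \<in> J" for i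
    using z(3)[of i] Mz[OF that] that by (simp add: a'_def)
  \<comment> \<open>If \<open>t = 0\<close>, then \<open>\<bar>p i\<bar> < a i < 1\<close> on
    \<open>J\<close> makes every \<open>p i\<close> zero; as the coordinates outside
    \<open>J\<close> vanish too, \<open>z\<close> would be zero.\<close>
  have t0: "t \<noteq> 0"
  proof
    assume t: "t = 0"
    have "z $ i = 0" for i
    proof (cases "i \<in> J")
      case True
      then have "\<bar>of_int (p i)\<bar> < (1::real)"
        using bd[OF True] a(2)[OF True] t by simp
      then have "p i = 0" by linarith
      then have "\<lfloor>z $ i\<rfloor> = 0"
        using t by (cases "i = i0") (simp_all add: p_def t_def)
      then show ?thesis
        using fl[of i] by simp
    next
      case False
      then have "i \<noteq> i0" using i0 by blast
      then have "(\<Sum>j\<in>UNIV. ?M $ i $ j * z $ j) = (\<Sum>j\<in>UNIV. if i = j then z $ j else 0)"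
        using False by (intro sum.cong) (auto simp: form_matrix_def)
      then have "(?M *v z) $ i = z $ i"
        by (simp add: matrix_vector_mult_def)
      then have "\<bar>z $ i\<bar> < 1" using z(3)[of i] False by (simp add: a'_def)
      then have "\<lfloor>z $ i\<rfloor> = 0 \<or> \<lfloor>z $ i\<rfloor> = -1" by linarith
      then show ?thesis using fl[of i] \<open>\<bar>z $ i\<bar> < 1\<close> by auto
    qed
    then show False using z(2) by (simp add: vec_eq_iff)
  qed
  show thesis
  proof (cases "t > 0")
    case True
    show thesis
      by (rule that[of "nat t" p]) (use True sum_p bd in auto)
  next
    \<comment> \<open>The bounds are symmetric under \<open>z \<mapsto> - z\<close>, so a negative
      \<open>t\<close> can be replaced by its opposite.\<close>
    case False
    show thesis
    proof (rule that[of "nat (- t)" "\<lambda>i. - p i"])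
      show "\<bar>real (nat (- t)) * b i - of_int (- p i)\<bar> < a i" if "i \<in> J" for i
        using bd[OF that] False by (simp add: abs_less_iff)
    qed (use False t0 sum_p in \<open>auto simp: sum_negf\<close>)
  qed
qed

section \<open>Lattice points with large coefficients\<close>

text \<open>A well-ordered copy of a finite type: \<open>measure_linear_image\<close> requires a well-ordered index type.\<close>
typedef 'a idx = "{..<CARD('a::finite)}"
  using zero_less_card_finite by blast

instance idx :: (finite) finite
proof
  have "inj (Rep_idx :: 'a idx \<Rightarrow> nat)"
    by (simp add: inj_on_def Rep_idx_inject)
  moreover have "range (Rep_idx :: 'a idx \<Rightarrow> nat) \<subseteq> {..<CARD('a)}"
    using Rep_idx by blast
  ultimately show "finite (UNIV :: 'a idx set)"
    using finite_imageD finite_subset[OF _ finite_lessThan] by blast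
qed

instantiation idx :: (finite) wellorder
begin

definition "less_eq_idx (i :: 'a idx) (j :: 'a idx) \<longleftrightarrow> Rep_idx i \<le> Rep_idx j"

definition "less_idx (i :: 'a idx) (j :: 'a idx) \<longleftrightarrow> Rep_idx i < Rep_idx j"

instance
proof
  fix i j k :: "'a idx"
  show "i < j \<longleftrightarrow> i \<le> j \<and> \<not> j \<le> i"
    by (auto simp: less_eq_idx_def less_idx_def)
  show "i \<le> i"
    by (simp add: less_eq_idx_def)
  show "i \<le> k" if "i \<le> j" "j \<le> k"
    using that by (simp add: less_eq_idx_def)
  show "i = j" if "i \<le> j" "j \<le> i"
    using that by (simp add: less_eq_idx_def flip: Rep_idx_inject)
  show "i \<le> j \<or> j \<le> i"
    by (auto simp: less_eq_idx_def)
next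
  fix P :: "'a idx \<Rightarrow> bool" and i
  assume step: "\<And>i. (\<And>j. j < i \<Longrightarrow> P j) \<Longrightarrow> P i"
  show "P i"
  proof (induction "Rep_idx i" arbitrary: i rule: less_induct)
    case less
    show ?case
    proof (rule step)
      fix j assume "j < i"
      then show "P j"
        using less[of j] by (simp add: less_idx_def)
    qed
  qed
qed

end

lemma ex_bij_idx: "\<exists>f :: 'a idx \<Rightarrow> 'a::finite. bij f"
proof -
  have "card (UNIV :: 'a idx set) = CARD('a)"
    using type_definition.card[OF type_definition_idx[where ?'a = 'a]] by simp
  then show ?thesis
    by (intro finite_same_card_bij) auto
qed

lemma ex_decreasing_enumeration:
  fixes b :: "'m::finite \<Rightarrow> real"
  obtains e where "bij_betw e {..<CARD('m)} (UNIV :: 'm set)"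
    "\<And>i j. i \<le> j \<Longrightarrow> j < CARD('m) \<Longrightarrow> b (e j) \<le> b (e i)"
proof -
  obtain xs0 :: "'m list" where xs0: "set xs0 = UNIV" "distinct xs0"
    using finite_distinct_list[of "UNIV :: 'm set"] by auto
  define xs where "xs = sort_key (\<lambda>i. - b i) xs0"
  have xs: "set xs = UNIV" "distinct xs" "sorted (map (\<lambda>i. - b i) xs)"
    using xs0 by (auto simp: xs_def)
  have len: "length xs = CARD('m)"
    using distinct_card[OF xs(2)] xs(1) by simp
  show thesis
  proof (rule that[of "\<lambda>i. xs ! i"])
    show "bij_betw ((!) xs) {..<CARD('m)} UNIV"
      by (rule bij_betw_nth) (simp_all add: xs len)
    show "b (xs ! j) \<le> b (xs ! i)" if "i \<le> j" "j < CARD('m)" for i j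
      using sorted_nth_mono[OF xs(3) that(1)] that len by simp
  qed
qed

section \<open>Maximizing the smallest coefficient\<close>

lemma lattice_point_intros:
  "lattice_point x \<Longrightarrow> lattice_point y \<Longrightarrow> lattice_point (x + y)"
  "lattice_point x \<Longrightarrow> lattice_point y \<Longrightarrow> lattice_point (x - y)"
  "(\<And>i. i \<in> I \<Longrightarrow> lattice_point (f i)) \<Longrightarrow> lattice_point (\<Sum>i\<in>I. f i)"
  "lattice_point x \<Longrightarrow> lattice_point (of_int n *\<^sub>R x)"
  by (auto simp: lattice_point_def)

text \<open>Having integer coordinates is a closed condition, so the nonnegative coefficient vectors
  of lattice points form a compact set \<open>B\<close>, on which the continuous function
  \<open>\<mu>\<close> attains its maximum.\<close>

lemma ex_max_min_coefficient:
  fixes v :: "'m::finite \<Rightarrow> real^'n" and \<beta>0 :: "'m \<Rightarrow> real"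
  assumes "\<And>i. 0 < \<beta>0 i" "(\<Sum>i\<in>UNIV. \<beta>0 i) = 1" "lattice_point (\<Sum>i\<in>UNIV. \<beta>0 i *\<^sub>R v i)"
  obtains m \<beta> where "0 < m" "\<And>i. m \<le> \<beta> i" "m \<in> range \<beta>" "(\<Sum>i\<in>UNIV. \<beta> i) = 1"
    "lattice_point (\<Sum>i\<in>UNIV. \<beta> i *\<^sub>R v i)"
    "\<forall>\<gamma>. (\<Sum>i\<in>UNIV. \<gamma> i) = 1 \<and> lattice_point (\<Sum>i\<in>UNIV. \<gamma> i *\<^sub>R v i) \<longrightarrow> (\<exists>i. \<gamma> i \<le> m)"
proof -
  define B :: "(real^'m) set" where "B = {x. (\<forall>i. 0 \<le> x $ i) \<and> (\<Sum>i\<in>UNIV. x $ i) = 1 \<and>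
     (\<forall>j. (\<Sum>i\<in>UNIV. x $ i *\<^sub>R v i) $ j \<in> \<int>)}"
  define \<mu> :: "real^'m \<Rightarrow> real" where "\<mu> x = (MIN i. x $ i)" for x
  have \<mu>_ge: "c \<le> \<mu> x \<longleftrightarrow> (\<forall>i. c \<le> x $ i)" for c x
    unfolding \<mu>_def by (subst Min_ge_iff) auto
  have "\<mu> x \<in> range (\<lambda>i. x $ i)" for x
    unfolding \<mu>_def by (rule Min_in) auto
  then have \<mu>_in: "\<exists>i. \<mu> x = x $ i" for x
    by (simp add: image_iff)
  have "closed {x :: real^'m. (\<Sum>i\<in>UNIV. x $ i *\<^sub>R v i) $ j \<in> \<int>}" for j
  proof -
    have "closed ((\<lambda>x :: real^'m. (\<Sum>i\<in>UNIV. x $ i *\<^sub>R v i) $ j) -` \<int>)"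
      by (intro closed_vimage closed_Ints continuous_intros)
    then show ?thesis by (simp add: vimage_def)
  qed
  then have "closed B"
    unfolding B_def
    by (intro closed_Collect_conj closed_Collect_all closed_Collect_le closed_Collect_eq continuous_intros) auto
  moreover have "bounded B"
  proof (rule boundedI)
    fix x assume x: "x \<in> B"
    have "norm x \<le> (\<Sum>i\<in>UNIV. \<bar>x $ i\<bar>)" by (rule norm_le_l1_cart)
    also have "\<dots> = 1" using x by (simp add: B_def)
    finally show "norm x \<le> 1" .
  qed
  ultimately have "compact B" by (simp add: compact_eq_bounded_closed)
  moreover have B0: "(\<chi> i. \<beta>0 i) \<in> B"
    using assms by (auto simp: B_def lattice_point_def intro: less_imp_le)
  moreover have "continuous_on B \<mu>"
    unfolding continuous_on_iff
  proof (intro ballI allI impI)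
    fix x :: "real^'m" and e :: real assume "e > 0"
    have "dist (\<mu> y) (\<mu> x) < e" if "dist y x < e" for y
    proof -
      have d: "\<bar>y $ i - x $ i\<bar> < e" for i
        using component_le_norm_cart[of "y - x" i] that by (simp add: dist_norm)
      obtain i j where "\<mu> x = x $ i" "\<mu> y = y $ j" using \<mu>_in by blast
      moreover have "\<mu> x \<le> x $ j" "\<mu> y \<le> y $ i" using \<mu>_ge by blast+
      ultimately show ?thesis using d[of i] d[of j] by (simp add: dist_real_def)
    qed
    then show "\<exists>d>0. \<forall>y\<in>B. dist y x < d \<longrightarrow> dist (\<mu> y) (\<mu> x) < e" using \<open>e > 0\<close> by blast
  qed
  ultimately obtain x where x: "x \<in> B" "\<And>y. y \<in> B \<Longrightarrow> \<mu> y \<le> \<mu> x"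
    using continuous_attains_sup[of B \<mu>] by blast
  have "0 < \<mu> (\<chi> i. \<beta>0 i)"
    using \<mu>_in[of "\<chi> i. \<beta>0 i"] assms(1) by auto
  then have pos: "0 < \<mu> x" using x(2)[OF B0] by simp
  show thesis
  proof (rule that[of "\<mu> x" "\<lambda>i. x $ i"])
    \<comment> \<open>A competitor with all coefficients above \<open>\<mu> x > 0\<close> is itself
      nonnegative and lies in \<open>B\<close>, so maximality over \<open>B\<close> extends to
      coefficients of any sign.\<close>
    have "\<exists>i. \<gamma> i \<le> \<mu> x" if \<gamma>: "(\<Sum>i\<in>UNIV. \<gamma> i) = 1" "lattice_point (\<Sum>i\<in>UNIV. \<gamma> i *\<^sub>R v i)" for \<gamma>
    proof (rule ccontr)
      assume "\<not> ?thesis"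
      then have gt: "\<mu> x < \<gamma> i" for i by (simp add: not_le)
      then have "(\<chi> i. \<gamma> i) \<in> B"
        using \<gamma> pos by (auto simp: B_def lattice_point_def intro: less_imp_le less_trans)
      then have "\<mu> (\<chi> i. \<gamma> i) \<le> \<mu> x" by (rule x(2))
      then show False using \<mu>_in[of "\<chi> i. \<gamma> i"] gt by (metis not_le vec_lambda_beta)
    qed
    then show "\<forall>\<gamma>. (\<Sum>i\<in>UNIV. \<gamma> i) = 1 \<and> lattice_point (\<Sum>i\<in>UNIV. \<gamma> i *\<^sub>R v i) \<longrightarrow> (\<exists>i. \<gamma> i \<le> \<mu> x)"
      by blast
    show "\<mu> x \<le> x $ i" for i using \<mu>_ge by blast
    show "\<mu> x \<in> range (($) x)" using \<mu>_in[of x] by auto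
  qed (use x(1) pos in \<open>auto simp: B_def lattice_point_def\<close>)
qed

lemma prod_le_of_max_min_coefficient:
  fixes v :: "'m::{finite,wellorder} \<Rightarrow> real^'n"
  assumes v: "\<And>i. lattice_point (v i)"
    and m: "0 < m" "\<And>i. m \<le> \<beta> i" and \<beta>: "(\<Sum>i\<in>UNIV. \<beta> i) = 1" "lattice_point (\<Sum>i\<in>UNIV. \<beta> i *\<^sub>R v i)"
    and max: "\<forall>\<gamma>. (\<Sum>i\<in>UNIV. \<gamma> i) = 1 \<and> lattice_point (\<Sum>i\<in>UNIV. \<gamma> i *\<^sub>R v i) \<longrightarrow> (\<exists>i. \<gamma> i \<le> m)"
    and J: "J \<noteq> {}" "J \<noteq> UNIV"
  shows "(\<Prod>i\<in>J. \<beta> i - m) \<le> 1 - (\<Sum>i\<in>J. \<beta> i)"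
proof (rule ccontr)
  assume "\<not> ?thesis"
  then have gt: "1 - (\<Sum>i\<in>J. \<beta> i) < (\<Prod>i\<in>J. \<beta> i - m)" by simp
  have pos: "0 < \<beta> i" for i using m(1) m(2)[of i] by linarith
  have split: "(\<Sum>i\<in>UNIV. f i) = (\<Sum>i\<in>J. f i) + (\<Sum>i\<in>-J. f i)" for f :: "'m \<Rightarrow> 'c::comm_monoid_add"
    by (subst sum.union_disjoint[symmetric]) auto
  have "0 < (\<Sum>i\<in>-J. \<beta> i)"
    using pos J(2) by (intro sum_pos) auto
  then have lt1: "(\<Sum>i\<in>J. \<beta> i) < 1" using \<beta>(1) split[of \<beta>] by simp
  \<comment> \<open>The tolerances of the approximation must be positive. A zero factor would make
    the product 0, below the positive number \<open>1 - (\<Sum>i\<in>J. \<beta> i)\<close>.\<close>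
  have nz: "0 < \<beta> i - m" if "i \<in> J" for i
  proof (rule ccontr)
    assume "\<not> 0 < \<beta> i - m"
    then have "\<beta> i - m = 0" using m(2)[of i] by simp
    then have "(\<Prod>i\<in>J. \<beta> i - m) = 0" using that by (intro prod_zero) auto
    then show False using gt lt1 by linarith
  qed
  have le1: "\<beta> i - m < 1" if "i \<in> J" for i
  proof -
    have "\<beta> i \<le> (\<Sum>i\<in>J. \<beta> i)"
      using that pos by (intro member_le_sum) (auto intro: less_imp_le)
    then show ?thesis using m(1) lt1 by simp
  qed
  obtain t :: nat and p :: "'m \<Rightarrow> int" where t: "t > 0" and p: "(\<Sum>i\<in>J. p i) = int t"
    and approx: "\<And>i. i \<in> J \<Longrightarrow> \<bar>real t * \<beta> i - of_int (p i)\<bar> < \<beta> i - m"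
    using simultaneous_approximation[OF lt1 nz le1 J(1) gt] by metis
  \<comment> \<open>On \<open>J\<close> this is \<open>\<beta> i\<close> plus an error smaller than
    \<open>\<beta> i - m\<close> in absolute value, hence above \<open>m\<close>; off
    \<open>J\<close> it is \<open>\<beta> i\<close> plus the positive number
    \<open>t * \<beta> i\<close>.\<close>
  define \<gamma> where "\<gamma> i = (1 + real t) * \<beta> i - (if i \<in> J then of_int (p i) else 0)" for i
  have "(\<Sum>i\<in>UNIV. \<gamma> i) = (1 + real t) - (\<Sum>i\<in>J. of_int (p i))"
    using \<beta>(1) by (simp add: \<gamma>_def sum_subtractf sum_distrib_left[symmetric] sum.If_cases)
  also have "\<dots> = 1"
    using p by (simp flip: of_int_sum)
  finally have sum1: "(\<Sum>i\<in>UNIV. \<gamma> i) = 1" .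
  have "(\<Sum>i\<in>UNIV. \<gamma> i *\<^sub>R v i) = of_int (1 + int t) *\<^sub>R (\<Sum>i\<in>UNIV. \<beta> i *\<^sub>R v i) -
      (\<Sum>i\<in>UNIV. of_int (if i \<in> J then p i else 0) *\<^sub>R v i)"
    unfolding scaleR_sum_right sum_subtractf[symmetric]
    by (intro sum.cong) (auto simp: \<gamma>_def scaleR_left_diff_distrib)
  also have "lattice_point \<dots>"
    by (rule lattice_point_intros(2)[OF lattice_point_intros(4)[OF \<beta>(2)]]) (intro lattice_point_intros v)
  finally obtain i where i: "\<gamma> i \<le> m"
    using max sum1 by blast
  show False
  proof (cases "i \<in> J")
    case True
    then show False using i approx[OF True] by (simp add: \<gamma>_def algebra_simps)
  next
    case False
    have "0 < real t * \<beta> i" using t pos[of i] by simp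
    then show False using False i m(2)[of i] by (simp add: \<gamma>_def algebra_simps)
  qed
qed

text \<open>In decreasing order the last coefficient is \<open>m\<close>. The first \<open>n\<close>
  ones form proper index sets, so their excesses over \<open>m\<close> meet the product-sum
  constraints; as they add up to \<open>1 - m - n * m\<close>, the Sylvester bound becomes a lower
  bound for \<open>(n + 1) * m\<close>.\<close>

lemma ex_large_coefficients_wellorder:
  fixes v :: "'m::{finite,wellorder} \<Rightarrow> real^'n" and \<beta>0 :: "'m \<Rightarrow> real"
  assumes v: "\<And>i. lattice_point (v i)"
    and "\<And>i. 0 < \<beta>0 i" "(\<Sum>i\<in>UNIV. \<beta>0 i) = 1" "lattice_point (\<Sum>i\<in>UNIV. \<beta>0 i *\<^sub>R v i)"
  obtains \<beta> where "\<And>i. 1 / (real CARD('m) * (real (sylvester CARD('m)) - 1)) \<le> \<beta> i"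
    "(\<Sum>i\<in>UNIV. \<beta> i) = 1" "lattice_point (\<Sum>i\<in>UNIV. \<beta> i *\<^sub>R v i)"
proof -
  obtain m \<beta> where m: "0 < m" "\<And>i. m \<le> \<beta> i" "m \<in> range \<beta>"
    and \<beta>: "(\<Sum>i\<in>UNIV. \<beta> i) = 1" "lattice_point (\<Sum>i\<in>UNIV. \<beta> i *\<^sub>R v i)"
    and max: "\<forall>\<gamma>. (\<Sum>i\<in>UNIV. \<gamma> i) = 1 \<and> lattice_point (\<Sum>i\<in>UNIV. \<gamma> i *\<^sub>R v i) \<longrightarrow> (\<exists>i. \<gamma> i \<le> m)"
    using ex_max_min_coefficient[OF assms(2-4)] by blast
  obtain e where e: "bij_betw e {..<CARD('m)} (UNIV :: 'm set)"
    and dec: "\<And>i j. i \<le> j \<Longrightarrow> j < CARD('m) \<Longrightarrow> \<beta> (e j) \<le> \<beta> (e i)"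
    using ex_decreasing_enumeration[of \<beta>] by blast
  obtain n where n: "CARD('m) = Suc n"
    using not0_implies_Suc[of "CARD('m)"] by auto
  have inj: "inj_on e {..<j}" if "j \<le> n" for j
    using e that n by (auto simp: bij_betw_def intro: inj_on_subset)
  have "\<beta> (e n) = m"
  proof -
    obtain i where i: "i < CARD('m)" "\<beta> (e i) = m"
      using m(3) e by (metis bij_betw_imp_surj_on imageE lessThan_iff UNIV_I)
    then show ?thesis using dec[of i n] m(2)[of "e n"] n by simp
  qed
  then have sum: "(\<Sum>i<n. \<beta> (e i)) + m = 1"
    using sum.reindex_bij_betw[OF e, of \<beta>] \<beta>(1) n by simp
  have "(\<Sum>i<n. \<beta> (e i) - m) \<le> 1 - 1 / (real (sylvester (Suc n)) - 1)"
  proof (rule sum_le_of_prod_le)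
    fix j assume j: "j \<le> n"
    show "(\<Prod>i<j. \<beta> (e i) - m) \<le> 1 - (\<Sum>i<j. \<beta> (e i) - m)"
    proof (cases "j = 0")
      case False
      have "card (e ` {..<j}) = j" using inj[OF j] by (simp add: card_image)
      then have "e ` {..<j} \<noteq> UNIV" using j n by (metis Suc_n_not_le_n)
      then have "(\<Prod>i\<in>e ` {..<j}. \<beta> i - m) \<le> 1 - (\<Sum>i\<in>e ` {..<j}. \<beta> i)"
        using False by (intro prod_le_of_max_min_coefficient[OF v m(1,2) \<beta> max]) auto
      also have "(\<Sum>i\<in>e ` {..<j}. \<beta> i) = (\<Sum>i<j. \<beta> (e i) - m) + real j * m"
        using inj[OF j] by (simp add: sum.reindex sum_subtractf)
      finally show ?thesis
        using m(1) inj[OF j] by (simp add: prod.reindex) (smt (verit) mult_nonneg_nonneg of_nat_0_le_iff)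
    qed simp
  qed (use dec m n in auto)
  then have "1 / (real (sylvester (Suc n)) - 1) \<le> (1 + real n) * m"
    using sum by (simp add: sum_subtractf algebra_simps)
  then have "1 / (real CARD('m) * (real (sylvester CARD('m)) - 1)) \<le> m"
    unfolding n mult.commute[of "real (Suc n)"] divide_divide_eq_left[symmetric]
    by (subst pos_divide_le_eq) (simp_all add: mult.commute)
  then show thesis
    using that[of \<beta>] m(2) \<beta> order_trans by blast
qed

text \<open>Transport along a bijection with \<open>'m idx\<close> removes the order on the index
  type.\<close>

theorem ex_large_coefficients:
  fixes v :: "'m::finite \<Rightarrow> real^'n" and \<beta>0 :: "'m \<Rightarrow> real"
  assumes "\<And>i. lattice_point (v i)" "\<And>i. 0 < \<beta>0 i" "(\<Sum>i\<in>UNIV. \<beta>0 i) = 1"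
    "lattice_point (\<Sum>i\<in>UNIV. \<beta>0 i *\<^sub>R v i)"
  obtains \<beta> where "\<And>i. 1 / (real CARD('m) * (real (sylvester CARD('m)) - 1)) \<le> \<beta> i"
    "(\<Sum>i\<in>UNIV. \<beta> i) = 1" "lattice_point (\<Sum>i\<in>UNIV. \<beta> i *\<^sub>R v i)"
proof -
  obtain f :: "'m idx \<Rightarrow> 'm" where f: "bij f"
    using ex_bij_idx by blast
  have card: "CARD('m idx) = CARD('m)"
    using bij_betw_same_card[OF f] .
  obtain \<beta> where \<beta>: "\<And>i. 1 / (real CARD('m) * (real (sylvester CARD('m)) - 1)) \<le> \<beta> i"
    "(\<Sum>i\<in>UNIV. \<beta> i) = 1" "lattice_point (\<Sum>i\<in>UNIV. \<beta> i *\<^sub>R v (f i))"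
    using ex_large_coefficients_wellorder[of "\<lambda>i. v (f i)" "\<lambda>i. \<beta>0 (f i)"] assms
    unfolding card sum.reindex_bij_betw[OF f, of \<beta>0]
      sum.reindex_bij_betw[OF f, of "\<lambda>i. \<beta>0 i *\<^sub>R v i"] by blast
  define g where "g = inv f"
  have gf: "g (f i) = i" for i
    using f by (simp add: g_def bij_is_inj)
  show thesis
  proof (rule that[of "\<lambda>i. \<beta> (g i)"])
    show "(\<Sum>i\<in>UNIV. \<beta> (g i)) = 1"
      using \<beta>(2) sum.reindex_bij_betw[OF f, of "\<lambda>i. \<beta> (g i)"] by (simp add: gf)
    show "lattice_point (\<Sum>i\<in>UNIV. \<beta> (g i) *\<^sub>R v i)"
      using \<beta>(3) sum.reindex_bij_betw[OF f, of "\<lambda>i. \<beta> (g i) *\<^sub>R v i"] by (simp add: gf)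
  qed (rule \<beta>(1))
qed

section \<open>Simplices of maximal volume\<close>

text \<open>The extra coordinate 1 at \<open>None\<close> turns affine relations into linear ones.
  The determinant of \<open>d + 1\<close> homogenized points is, up to sign, \<open>d!\<close> times
  the volume of their simplex.\<close>

definition homogenize :: "real^'n \<Rightarrow> real^('n option)" where
  "homogenize u = (\<chi> c. case c of None \<Rightarrow> 1 | Some i \<Rightarrow> u $ i)"

lemma homogenize_eq_sum_iff:
  fixes w :: "'i \<Rightarrow> real^'n"
  assumes "finite I"
  shows "homogenize u = (\<Sum>i\<in>I. l i *\<^sub>R homogenize (w i)) \<longleftrightarrow>
    (\<Sum>i\<in>I. l i) = 1 \<and> (\<Sum>i\<in>I. l i *\<^sub>R w i) = u"
proof -
  have "homogenize u = (\<Sum>i\<in>I. l i *\<^sub>R homogenize (w i)) \<longleftrightarrow>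
    homogenize u $ None = (\<Sum>i\<in>I. l i *\<^sub>R homogenize (w i)) $ None \<and>
    (\<forall>c. homogenize u $ Some c = (\<Sum>i\<in>I. l i *\<^sub>R homogenize (w i)) $ Some c)"
    unfolding vec_eq_iff split_option_all ..
  also have "\<dots> \<longleftrightarrow> (\<Sum>i\<in>I. l i) = 1 \<and> (\<Sum>i\<in>I. l i *\<^sub>R w i) = u"
    by (auto simp: homogenize_def vec_eq_iff)
  finally show ?thesis .
qed

text \<open>A nonzero vector orthogonal to all homogenized points would be the equation of a
  hyperplane containing \<open>V\<close>.\<close>

lemma span_homogenize_eq_UNIV:
  fixes V :: "(real^'n) set"
  assumes "V \<noteq> {}" and dim: "aff_dim V = int CARD('n)"
  shows "span (homogenize ` V) = UNIV"
proof (rule ccontr)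
  assume "\<not> ?thesis"
  then obtain a where a: "a \<noteq> 0" "\<And>x. x \<in> span (homogenize ` V) \<Longrightarrow> a \<bullet> x = 0"
    using span_not_UNIV_orthogonal by blast
  define a' :: "real^'n" where "a' = (\<chi> i. a $ Some i)"
  have eq: "a $ None + a' \<bullet> v = 0" if "v \<in> V" for v
  proof -
    have "a \<bullet> homogenize v = 0" using a(2) that by (simp add: span_base)
    also have "a \<bullet> homogenize v = a $ None + a' \<bullet> v"
      by (simp add: inner_vec_def UNIV_option_conv sum.reindex homogenize_def a'_def)
    finally show ?thesis .
  qed
  have "a' \<noteq> 0"
  proof
    assume a': "a' = 0"
    then have "a $ None = 0"
      using eq assms(1) by auto
    moreover have "a $ Some i = 0" for i
      using arg_cong[OF a', of "\<lambda>x. x $ i"] by (simp add: a'_def)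
    ultimately have "a $ c = 0" for c
      by (cases c) auto
    then show False using a(1) by (simp add: vec_eq_iff)
  qed
  have "V \<subseteq> {x. a' \<bullet> x = - a $ None}" using eq by force
  then have "aff_dim V \<le> aff_dim {x. a' \<bullet> x = - a $ None}" by (rule aff_dim_subset)
  then show False using dim \<open>a' \<noteq> 0\<close> by simp
qed

text \<open>Take \<open>w\<close> with the largest absolute determinant, that is, the largest
  volume. By Cramer's rule, replacing \<open>w k\<close> by \<open>u\<close> multiplies the
  determinant by the \<open>k\<close>-th barycentric coordinate of \<open>u\<close>, which therefore
  cannot exceed 1.\<close>

lemma ex_max_simplex:
  fixes V :: "(real^'n) set"
  assumes fin: "finite V" and ne: "V \<noteq> {}" and dim: "aff_dim V = int CARD('n)"
  obtains w :: "'n option \<Rightarrow> real^'n" where "\<And>i. w i \<in> V"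
    "\<And>u. u \<in> V \<Longrightarrow> \<exists>l. (\<Sum>i\<in>UNIV. l i) = 1 \<and> (\<Sum>i\<in>UNIV. l i *\<^sub>R w i) = u \<and> (\<forall>i. l i \<le> 1)"
proof -
  define D :: "('n option \<Rightarrow> real^'n) \<Rightarrow> real^('n option)^('n option)" where "D w = (\<chi> i. homogenize (w i))" for w
  define F where "F = {w :: 'n option \<Rightarrow> real^'n. \<forall>i. w i \<in> V}"
  have finF: "finite F"
    using finite_PiE[of "UNIV :: 'n option set" "\<lambda>_. V"] fin by (simp add: F_def PiE_def Pi_def)
  \<comment> \<open>A basis chosen among the homogenized points shows that the maximal determinant
    is nonzero.\<close>
  obtain w1 where w1: "w1 \<in> F" "det (D w1) \<noteq> 0"
  proof -
    obtain B where B: "B \<subseteq> homogenize ` V" "independent B" "homogenize ` V \<subseteq> span B"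
      using maximal_independent_subset by blast
    have "span B = UNIV"
      using B span_homogenize_eq_UNIV[OF ne dim] span_mono[of B] span_minimal[OF B(3)] by auto
    then have "card B = CARD('n option)"
      using B(2) by (metis basis_card_eq_dim dim_UNIV DIM_cart DIM_real mult.right_neutral top_greatest)
    moreover have "finite B" using B(1) fin finite_surj by blast
    ultimately obtain f :: "'n option \<Rightarrow> real^('n option)" where f: "bij_betw f UNIV B"
      by (metis finite_same_card_bij finite)
    have "\<forall>i. \<exists>v\<in>V. f i = homogenize v"
      using f B(1) by (auto simp: bij_betw_def)
    then obtain w where w: "\<And>i. w i \<in> V" "\<And>i. f i = homogenize (w i)" by metis
    have "rows (D w) = B"
      using f by (auto simp: rows_def row_def D_def bij_betw_def vec_lambda_eta w(2)[symmetric])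
    then have "vec.span (rows (D w)) = UNIV"
      using \<open>span B = UNIV\<close> by (simp add: span_vec_eq)
    then have "det (D w) \<noteq> 0"
      by (metis invertible_det_nz matrix_left_invertible_span_rows_gen invertible_left_inverse)
    moreover have "w \<in> F" using w(1) by (simp add: F_def)
    ultimately show thesis by (rule that[rotated])
  qed
  obtain w where w: "w \<in> F" "\<And>w'. w' \<in> F \<Longrightarrow> \<bar>det (D w')\<bar> \<le> \<bar>det (D w)\<bar>"
  proof -
    let ?g = "\<lambda>w. \<bar>det (D w)\<bar>"
    have "Max (?g ` F) \<in> ?g ` F"
      using finF w1(1) by (intro Max_in) auto
    then obtain w where "w \<in> F" "Max (?g ` F) = ?g w" by blast
    then show thesis
      using that[of w] finF by (metis Max_ge finite_imageI imageI)
  qed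
  have det: "det (D w) \<noteq> 0" using w(2)[OF w1(1)] w1(2) by auto
  show thesis
  proof (rule that[of w])
    show "w i \<in> V" for i using w(1) by (simp add: F_def)
    fix u assume u: "u \<in> V"
    obtain x where x: "transpose (D w) *v x = homogenize u"
      using cramer[of "transpose (D w)" _ "homogenize u"] det by simp
    have hu: "homogenize u = (\<Sum>i\<in>UNIV. x $ i *\<^sub>R homogenize (w i))"
      unfolding x[symmetric] matrix_mult_sum
      by (simp add: column_transpose row_def D_def vec_lambda_eta scalar_mult_eq_scaleR)
    have "x $ k \<le> 1" for k
    proof -
      have "w(k := u) \<in> F" using w(1) u by (auto simp: F_def)
      then have "\<bar>det (D (w(k := u)))\<bar> \<le> \<bar>det (D w)\<bar>" by (rule w(2))
      also have "D (w(k := u)) = (\<chi> i. if i = k then (\<Sum>i\<in>UNIV. x $ i *s row i (D w)) else row i (D w))"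
        using hu by (simp add: vec_eq_iff D_def row_def scalar_mult_eq_scaleR)
      also have "det \<dots> = x $ k * det (D w)" by (rule cramer_lemma_transpose)
      finally show ?thesis using det by (simp add: abs_mult)
    qed
    then show "\<exists>l. (\<Sum>i\<in>UNIV. l i) = 1 \<and> (\<Sum>i\<in>UNIV. l i *\<^sub>R w i) = u \<and> (\<forall>i. l i \<le> 1)"
      using hu by (intro exI[of _ "\<lambda>i. x $ i"]) (auto simp: homogenize_eq_sum_iff)
  qed
qed

section \<open>Lattice simplices and lattice polytopes\<close>

text \<open>Interior points of a simplex are the combinations of its vertices with positive
  coefficients. So an interior lattice point provides the starting combination, and the improved one
  is interior again. The vertices are indexed by \<open>'n option\<close>, which has
  \<open>d + 1\<close> elements.\<close>

lemma simplex_ex_large_barycentric_coords: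
  fixes V :: "(real^'n) set"
  assumes V: "\<And>v. v \<in> V \<Longrightarrow> lattice_point v" and indep: "\<not> affine_dependent V"
    and card: "card V = CARD('n) + 1" and k: "num_interior_lattice_points (convex hull V) \<ge> 1"
  shows "\<exists>x \<beta>. x \<in> interior (convex hull V) \<and> lattice_point x \<and> barycentric_coords V \<beta> x \<and>
    (\<forall>v\<in>V. \<beta> v \<ge> 1 / (real (CARD('n) + 1) * (real (sylvester (CARD('n) + 1)) - 1)))"
proof -
  have int: "interior (convex hull V) =
      {y. \<exists>u. (\<forall>x \<in> V. 0 < u x) \<and> sum u V = 1 \<and> (\<Sum>x\<in>V. u x *\<^sub>R x) = y}"
    using interior_convex_hull_explicit_minimal[OF indep] card by simp
  have "{x \<in> interior (convex hull V). lattice_point x} \<noteq> {}"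
    using k unfolding num_interior_lattice_points_def by (metis card.empty not_one_le_zero)
  then obtain u where u: "\<And>x. x \<in> V \<Longrightarrow> 0 < u x" "sum u V = 1" "lattice_point (\<Sum>x\<in>V. u x *\<^sub>R x)"
    unfolding int by blast
  have "finite V" using card by (metis card.infinite Suc_eq_plus1 nat.simps(3))
  then obtain f :: "'n option \<Rightarrow> real^'n" where f: "bij_betw f UNIV V"
    using finite_same_card_bij[of "UNIV :: 'n option set" V] card by auto
  have fV: "f i \<in> V" for i using f by (auto simp: bij_betw_def)
  define m where "m = 1 / (real (CARD('n) + 1) * (real (sylvester (CARD('n) + 1)) - 1))"
  obtain \<gamma> where \<gamma>: "\<And>i. m \<le> \<gamma> i" "(\<Sum>i\<in>UNIV. \<gamma> i) = 1" "lattice_point (\<Sum>i\<in>UNIV. \<gamma> i *\<^sub>R f i)"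
    using ex_large_coefficients[of f "\<lambda>i. u (f i)"] V[OF fV] u fV
    unfolding sum.reindex_bij_betw[OF f, of u] sum.reindex_bij_betw[OF f, of "\<lambda>x. u x *\<^sub>R x"]
    by (auto simp: m_def)
  have "0 < m" using sylvester_gt_1[of "CARD('n)"] by (simp add: m_def)
  define \<beta> where "\<beta> v = \<gamma> (inv f v)" for v
  have \<beta>f: "\<beta> (f i) = \<gamma> i" for i
    using f by (simp add: \<beta>_def bij_betw_def)
  define x where "x = (\<Sum>v\<in>V. \<beta> v *\<^sub>R v)"
  have m\<beta>: "\<forall>v\<in>V. m \<le> \<beta> v" using \<gamma>(1) by (simp add: \<beta>_def)
  have sum1: "(\<Sum>v\<in>V. \<beta> v) = 1"
    using \<gamma>(2) sum.reindex_bij_betw[OF f, of \<beta>] by (simp add: \<beta>f)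
  have "lattice_point x"
    using \<gamma>(3) sum.reindex_bij_betw[OF f, of "\<lambda>v. \<beta> v *\<^sub>R v"] by (simp add: \<beta>f x_def)
  moreover have "x \<in> interior (convex hull V)"
    unfolding int using m\<beta> \<open>0 < m\<close> sum1 x_def by (auto intro!: exI[of _ \<beta>] intro: less_le_trans)
  ultimately show ?thesis
    using sum1 m\<beta> unfolding barycentric_coords_def m_def[symmetric] x_def by blast
qed

section \<open>Positive combinations of few vertices\<close>

text \<open>Follow the ray from \<open>c\<close> through \<open>y\<close> to the boundary and apply Caratheodory's theorem in a
  supporting hyperplane, which saves one point.\<close>
lemma ex_boundary_combination:
  fixes V :: "(real^'n) set"
  assumes fin: "finite V" and c: "c \<in> convex hull V" and y: "y \<in> interior (convex hull V)"
  obtains S h \<tau> where "S \<subseteq> V" "finite S" "card S \<le> CARD('n)" "\<And>x. x \<in> S \<Longrightarrow> 0 < h x" "0 < \<tau>"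
    "\<tau> + (\<Sum>x\<in>S. h x) = 1" "y = \<tau> *\<^sub>R c + (\<Sum>x\<in>S. h x *\<^sub>R x)"
proof (cases "y = c")
  case True
  show thesis
    by (rule that[of "{}" "\<lambda>_. 1" 1]) (use True in auto)
next
  case False
  define P where "P = convex hull V"
  have P: "convex P" "compact P"
    using fin by (auto simp: P_def finite_imp_compact_convex_hull)
  obtain \<delta> where \<delta>: "0 < \<delta>" "y + \<delta> *\<^sub>R (y - c) \<in> frontier P"
  proof (rule ray_to_frontier[of P y "y - c"])
    show "bounded P" using P(2) by (rule compact_imp_bounded)
    show "y \<in> interior P" using y by (simp add: P_def)
    show "y - c \<noteq> 0" using False by simp
  qed
  define q where "q = y + \<delta> *\<^sub>R (y - c)"
  have qP: "q \<in> P" "q \<notin> interior P"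
    using \<delta>(2) P(2) by (auto simp: q_def frontier_def compact_imp_closed)
  moreover have "rel_interior P = interior P"
    using y by (intro rel_interior_nonempty_interior) (auto simp: P_def)
  ultimately obtain a where a: "a \<noteq> 0" "\<And>p. p \<in> P \<Longrightarrow> a \<bullet> q \<le> a \<bullet> p"
    using supporting_hyperplane_rel_boundary[OF P(1)] by metis
  \<comment> \<open>Since \<open>q\<close> minimizes \<open>a \<bullet> p\<close> over
    \<open>P\<close>, any convex combination giving \<open>q\<close> puts all its weight on the
    points of \<open>V\<close> in this hyperplane.\<close>
  define F where "F = {x \<in> V. a \<bullet> x = a \<bullet> q}"
  obtain \<mu> where \<mu>: "\<And>v. v \<in> V \<Longrightarrow> 0 \<le> \<mu> v" "sum \<mu> V = 1" "(\<Sum>v\<in>V. \<mu> v *\<^sub>R v) = q"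
    using qP(1) unfolding P_def convex_hull_finite[OF fin] by blast
  have "(\<Sum>v\<in>V. \<mu> v * (a \<bullet> v - a \<bullet> q)) = a \<bullet> (\<Sum>v\<in>V. \<mu> v *\<^sub>R v) - sum \<mu> V * (a \<bullet> q)"
    by (simp add: inner_sum_right sum_subtractf right_diff_distrib sum_distrib_right)
  also have "\<dots> = 0" by (simp add: \<mu>)
  finally have "\<forall>v\<in>V. \<mu> v * (a \<bullet> v - a \<bullet> q) = 0"
    using \<mu>(1) a(2) hull_inc[of _ V convex] fin
    by (subst (asm) sum_nonneg_eq_0_iff) (auto simp: P_def)
  then have zero: "\<mu> v = 0" if "v \<in> V - F" for v
    using that by (auto simp: F_def)
  have FV: "F \<subseteq> V" "finite F" using fin by (auto simp: F_def)
  have "sum \<mu> F = 1" "(\<Sum>v\<in>F. \<mu> v *\<^sub>R v) = q"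
    using sum.mono_neutral_left[OF fin FV(1), of \<mu>] sum.mono_neutral_left[OF fin FV(1), of "\<lambda>v. \<mu> v *\<^sub>R v"]
      zero \<mu> by auto
  then have "q \<in> convex hull F"
    unfolding convex_hull_finite[OF FV(2)] using \<mu>(1) FV by blast
  then obtain S u where S: "finite S" "S \<subseteq> F" "card S \<le> aff_dim F + 1" "\<And>x. x \<in> S \<Longrightarrow> 0 \<le> u x"
    "sum u S = 1" "(\<Sum>v\<in>S. u v *\<^sub>R v) = q"
    unfolding convex_hull_caratheodory_aff_dim by blast
  \<comment> \<open>\<open>F\<close> has affine dimension at most \<open>d - 1\<close>, so
    Caratheodory's theorem needs only \<open>d\<close> points.\<close>
  have "aff_dim F \<le> aff_dim {x. a \<bullet> x = a \<bullet> q}"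
    by (rule aff_dim_subset) (auto simp: F_def)
  then have card: "card S \<le> CARD('n)" using S(3) a(1) by simp
  define S' where "S' = {x \<in> S. 0 < u x}"
  have S': "S' \<subseteq> S" "finite S'" using S(1) by (auto simp: S'_def)
  have zero': "\<forall>x\<in>S - S'. u x = 0" using S(4) by (force simp: S'_def)
  have sum': "sum u S' = 1" "(\<Sum>v\<in>S'. u v *\<^sub>R v) = q"
    using sum.mono_neutral_left[OF S(1) S'(1), of u] sum.mono_neutral_left[OF S(1) S'(1), of "\<lambda>v. u v *\<^sub>R v"]
      zero' S by auto
  show thesis
  proof (rule that[of S' "\<lambda>x. u x / (1 + \<delta>)" "\<delta> / (1 + \<delta>)"])
    show "S' \<subseteq> V" using S' S(2) FV by blast
    show "card S' \<le> CARD('n)" using card card_mono[OF S(1) S'(1)] by simp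
    show "\<delta> / (1 + \<delta>) + (\<Sum>x\<in>S'. u x / (1 + \<delta>)) = 1"
      using \<delta>(1) sum'(1) by (simp add: field_simps flip: sum_divide_distrib)
    have "y = (1 / (1 + \<delta>)) *\<^sub>R ((1 + \<delta>) *\<^sub>R y)"
      using \<delta>(1) by simp
    also have "(1 + \<delta>) *\<^sub>R y = \<delta> *\<^sub>R c + q"
      by (simp add: q_def algebra_simps)
    also have "(1 / (1 + \<delta>)) *\<^sub>R (\<delta> *\<^sub>R c + q) = (\<delta> / (1 + \<delta>)) *\<^sub>R c + (1 / (1 + \<delta>)) *\<^sub>R q"
      by (simp add: scaleR_right_distrib)
    also have "(1 / (1 + \<delta>)) *\<^sub>R q = (\<Sum>x\<in>S'. (u x / (1 + \<delta>)) *\<^sub>R x)"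
      unfolding sum'(2)[symmetric] scaleR_sum_right by (intro sum.cong) simp_all
    finally show "y = (\<delta> / (1 + \<delta>)) *\<^sub>R c + (\<Sum>x\<in>S'. (u x / (1 + \<delta>)) *\<^sub>R x)" .
  qed (use S' \<delta>(1) in \<open>auto simp: S'_def\<close>)
qed

text \<open>The unused indices of the right summand repeat the point \<open>w None\<close>, each with the small
  weight \<open>\<kappa>\<close> taken from the left summand.\<close>
lemma ex_positive_combination:
  fixes V :: "(real^'n) set" and w :: "'n option \<Rightarrow> real^'n"
  assumes fin: "finite V" and w: "\<And>i. w i \<in> V" and y: "y \<in> interior (convex hull V)"
  obtains f :: "'n option + 'n \<Rightarrow> real^'n" and \<beta> where "\<forall>i. f (Inl i) = w i" "\<forall>i. f i \<in> V"
    "\<forall>i. 0 < \<beta> i" "(\<Sum>i\<in>UNIV. \<beta> i) = 1" "(\<Sum>i\<in>UNIV. \<beta> i *\<^sub>R f i) = y"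
proof -
  define N where "N = real CARD('n option)"
  have N: "N > 0" by (simp add: N_def)
  \<comment> \<open>The barycentre gives every \<open>w i\<close> the same positive weight
    \<open>\<tau> / N\<close>.\<close>
  define c where "c = (\<Sum>i\<in>UNIV. (1 / N) *\<^sub>R w i)"
  have "c \<in> convex hull V"
    unfolding c_def using w N by (intro convex_sum) (auto simp: N_def hull_inc)
  then obtain S h \<tau> where S: "S \<subseteq> V" "finite S" "card S \<le> CARD('n)" and h: "\<And>x. x \<in> S \<Longrightarrow> 0 < h x"
    and \<tau>: "0 < \<tau>" and sum1: "\<tau> + (\<Sum>x\<in>S. h x) = 1" and y_eq: "y = \<tau> *\<^sub>R c + (\<Sum>x\<in>S. h x *\<^sub>R x)"
    using ex_boundary_combination[OF fin _ y] by blast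
  obtain g :: "real^'n \<Rightarrow> 'n" where g: "inj_on g S"
    using S(2,3) by (metis card_le_inj finite)
  define R where "R = - g ` S"
  \<comment> \<open>Chosen so that \<open>w None\<close>, after giving up \<open>\<kappa>\<close>
    for each index in \<open>R\<close>, still keeps exactly \<open>\<kappa>\<close>.\<close>
  define \<kappa> where "\<kappa> = \<tau> / (N * (real (card R) + 1))"
  have \<kappa>: "\<kappa> > 0" using \<tau> N by (simp add: \<kappa>_def)
  have \<kappa>': "\<tau> / N - real (card R) * \<kappa> = \<kappa>"
  proof -
    have "(real (card R) + 1) * \<kappa> = \<tau> / N"
      using N by (simp add: \<kappa>_def add_nonneg_eq_0_iff)
    then show ?thesis by (simp add: algebra_simps)
  qed
  define f where "f = case_sum w (\<lambda>j. if j \<in> R then w None else inv_into S g j)"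
  define \<beta> :: "'n option + 'n \<Rightarrow> real" where "\<beta> = case_sum (\<lambda>i. \<tau> / N - (if i = None then real (card R) * \<kappa> else 0))
     (\<lambda>j. if j \<in> R then \<kappa> else h (inv_into S g j))"
  have split: "(\<Sum>i\<in>UNIV. H i) = (\<Sum>i\<in>UNIV. H (Inl i)) + ((\<Sum>j\<in>R. H (Inr j)) + (\<Sum>x\<in>S. H (Inr (g x))))"
    for H :: "'n option + 'n \<Rightarrow> 'b::comm_monoid_add"
  proof -
    have "(\<Sum>i\<in>UNIV. H i) = (\<Sum>i\<in>UNIV. H (Inl i)) + (\<Sum>j\<in>UNIV. H (Inr j))"
      by (simp add: sum.Plus flip: UNIV_Plus_UNIV)
    also have "(\<Sum>j\<in>UNIV. H (Inr j)) = (\<Sum>j\<in>R. H (Inr j)) + (\<Sum>j\<in>g ` S. H (Inr j))"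
      by (subst sum.union_disjoint[symmetric]) (auto simp: R_def)
    also have "(\<Sum>j\<in>g ` S. H (Inr j)) = (\<Sum>x\<in>S. H (Inr (g x)))"
      using g by (simp add: sum.reindex)
    finally show ?thesis .
  qed
  have gS: "g x \<notin> R" "inv_into S g (g x) = x" if "x \<in> S" for x
    using that g by (auto simp: R_def)
  have not_R: "inv_into S g j \<in> S" if "j \<notin> R" for j
    using that by (auto simp: R_def intro: inv_into_into)
  show thesis
  proof (rule that[of f \<beta>])
    show "\<forall>i. f (Inl i) = w i" by (simp add: f_def)
    show "\<forall>i. f i \<in> V"
    proof
      fix i show "f i \<in> V"
        using w S(1) not_R by (cases i) (auto simp: f_def)
    qed
    show "\<forall>i. 0 < \<beta> i"
    proof
      fix i show "0 < \<beta> i"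
        using \<kappa> \<kappa>' \<tau> N h not_R by (cases i) (auto simp: \<beta>_def)
    qed
    have "(\<Sum>i\<in>UNIV. \<beta> i) = (\<tau> - real (card R) * \<kappa>) + (real (card R) * \<kappa> + (\<Sum>x\<in>S. h x))"
      unfolding split using N by (simp add: \<beta>_def gS sum_subtractf N_def cong: sum.cong)
    then show "(\<Sum>i\<in>UNIV. \<beta> i) = 1" using sum1 by simp
    have "(\<Sum>i\<in>UNIV. \<beta> (Inl i) *\<^sub>R f (Inl i)) =
        (\<Sum>i\<in>UNIV. (\<tau> / N) *\<^sub>R w i - (if i = None then (real (card R) * \<kappa>) *\<^sub>R w None else 0))"
      by (intro sum.cong) (auto simp: \<beta>_def f_def scaleR_left_diff_distrib)
    also have "\<dots> = \<tau> *\<^sub>R c - (real (card R) * \<kappa>) *\<^sub>R w None"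
      by (simp add: sum_subtractf c_def scaleR_sum_right)
    finally have Inl: "(\<Sum>i\<in>UNIV. \<beta> (Inl i) *\<^sub>R f (Inl i)) = \<tau> *\<^sub>R c - (real (card R) * \<kappa>) *\<^sub>R w None" .
    have R: "(\<Sum>j\<in>R. \<beta> (Inr j) *\<^sub>R f (Inr j)) = (real (card R) * \<kappa>) *\<^sub>R w None"
      by (simp add: \<beta>_def f_def sum_constant_scaleR del: sum_constant)
    have "(\<Sum>i\<in>UNIV. \<beta> i *\<^sub>R f i) = (\<tau> *\<^sub>R c - (real (card R) * \<kappa>) *\<^sub>R w None) +
        ((real (card R) * \<kappa>) *\<^sub>R w None + (\<Sum>x\<in>S. h x *\<^sub>R x))"
      unfolding split Inl R by (simp add: \<beta>_def f_def gS cong: sum.cong)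
    then show "(\<Sum>i\<in>UNIV. \<beta> i *\<^sub>R f i) = y" by (simp add: y_eq)
  qed
qed

section \<open>Volume estimates\<close>

text \<open>For vertices \<open>p\<close> and \<open>q\<close>, moving weight \<open>m\<close> from
  one coefficient to another keeps all coefficients nonnegative. The general case follows by
  convexity in \<open>p\<close> and in \<open>q\<close> separately.\<close>

lemma translated_difference_subset:
  fixes f :: "'m::finite \<Rightarrow> 'v::real_vector" and w :: "'i \<Rightarrow> 'm"
  assumes \<beta>: "\<And>j. m \<le> \<beta> j" "(\<Sum>j\<in>UNIV. \<beta> j) = 1" and m: "0 \<le> m" and P: "convex P" "\<And>j. f j \<in> P"
    and p: "p \<in> convex hull (range (\<lambda>i. f (w i)))" and q: "q \<in> convex hull (range (\<lambda>i. f (w i)))"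
  shows "(\<Sum>j\<in>UNIV. \<beta> j *\<^sub>R f j) + m *\<^sub>R p - m *\<^sub>R q \<in> P"
proof -
  define y where "y = (\<Sum>j\<in>UNIV. \<beta> j *\<^sub>R f j)"
  have vertices: "y + m *\<^sub>R f i - m *\<^sub>R f i' \<in> P" for i i'
  proof -
    define \<gamma> where "\<gamma> j = \<beta> j + (if j = i then m else 0) - (if j = i' then m else 0)" for j
    have "(\<Sum>j\<in>UNIV. \<gamma> j *\<^sub>R f j) \<in> P"
    proof (rule convex_sum[OF finite P(1)])
      show "(\<Sum>j\<in>UNIV. \<gamma> j) = 1" using \<beta>(2) by (simp add: \<gamma>_def sum.distrib sum_subtractf)
      show "0 \<le> \<gamma> j" for j using \<beta>(1)[of j] m by (auto simp: \<gamma>_def)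
    qed (rule P(2))
    also have "(\<Sum>j\<in>UNIV. \<gamma> j *\<^sub>R f j) =
        (\<Sum>j\<in>UNIV. \<beta> j *\<^sub>R f j + (if j = i then m *\<^sub>R f i else 0) - (if j = i' then m *\<^sub>R f i' else 0))"
      by (intro sum.cong) (auto simp: \<gamma>_def algebra_simps)
    finally show ?thesis by (simp add: y_def sum.distrib sum_subtractf)
  qed
  have "convex {p. y + m *\<^sub>R p - m *\<^sub>R q \<in> P}" for q
  proof -
    have "{p. y + m *\<^sub>R p - m *\<^sub>R q \<in> P} = (\<lambda>p. m *\<^sub>R p) -` ((+) (m *\<^sub>R q - y) ` P)"
      by (force simp: image_iff algebra_simps)
    then show ?thesis
      using P(1) by (simp add: convex_linear_vimage convex_translation)
  qed
  then have "y + m *\<^sub>R p - m *\<^sub>R f i \<in> P" for i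
    using hull_minimal[of "range (\<lambda>i. f (w i))" "{p. y + m *\<^sub>R p - m *\<^sub>R f i \<in> P}" convex] vertices p by auto
  moreover have "convex {q. y + m *\<^sub>R p - m *\<^sub>R q \<in> P}"
  proof -
    have "{q. y + m *\<^sub>R p - m *\<^sub>R q \<in> P} = (\<lambda>q. (- m) *\<^sub>R q) -` ((+) (- (y + m *\<^sub>R p)) ` P)"
      by (force simp: image_iff algebra_simps)
    then show ?thesis
      using P(1) by (simp only: convex_linear_vimage convex_translation linear_scaleR)
  qed
  ultimately show ?thesis
    using hull_minimal[of "range (\<lambda>i. f (w i))" "{q. y + m *\<^sub>R p - m *\<^sub>R q \<in> P}" convex] q
    by (auto simp: y_def)
qed

text \<open>If all \<open>l i \<le> 1\<close>, the numbers \<open>(1 - l i) / d\<close> are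
  nonnegative, and their sum is \<open>(d + 1 - 1) / d = 1\<close>. So they are the weights of a
  point of \<open>T\<close> that \<open>\<phi>\<close> maps to \<open>u\<close>, and
  \<open>\<phi>\<close> scales volume by \<open>d ^ d\<close>.\<close>

lemma measure_convex_hull_le_simplex:
  fixes V :: "(real^'n) set" and w :: "'n option \<Rightarrow> real^'n"
  assumes fin: "finite V"
    and l: "\<And>u. u \<in> V \<Longrightarrow> \<exists>l. (\<Sum>i\<in>UNIV. l i) = 1 \<and> (\<Sum>i\<in>UNIV. l i *\<^sub>R w i) = u \<and> (\<forall>i. l i \<le> 1)"
  shows "measure lebesgue (convex hull V) \<le> real CARD('n) ^ CARD('n) * measure lebesgue (convex hull (range w))"
proof -
  define d where "d = real CARD('n)"
  have d: "d > 0" by (simp add: d_def)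
  define T where "T = convex hull (range w)"
  define \<phi> where "\<phi> = (\<lambda>x. (- d) *\<^sub>R x + (\<Sum>i\<in>UNIV. w i))"
  have "compact T" by (simp add: T_def finite_imp_compact_convex_hull)
  then have T: "compact (\<phi> ` T)" unfolding \<phi>_def
    by (intro compact_continuous_image continuous_intros)
  have "convex (\<phi> ` T)"
    using convex_affinity[of T "\<Sum>i\<in>UNIV. w i" "- d"]
    by (simp add: \<phi>_def T_def add.commute)
  moreover have "V \<subseteq> \<phi> ` T"
  proof
    fix u assume "u \<in> V"
    then obtain l where l: "(\<Sum>i\<in>UNIV. l i) = 1" "(\<Sum>i\<in>UNIV. l i *\<^sub>R w i) = u" "\<And>i. l i \<le> 1"
      using l by blast
    have "(\<Sum>i\<in>UNIV. ((1 - l i) / d) *\<^sub>R w i) \<in> T"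
    proof (rule convex_sum)
      show "(\<Sum>i\<in>UNIV. (1 - l i) / d) = 1"
        using l(1) d by (simp add: sum_subtractf d_def flip: sum_divide_distrib)
    qed (use l(3) d in \<open>auto simp: T_def hull_inc\<close>)
    moreover have "u = \<phi> (\<Sum>i\<in>UNIV. ((1 - l i) / d) *\<^sub>R w i)"
    proof -
      have "d *\<^sub>R (\<Sum>i\<in>UNIV. ((1 - l i) / d) *\<^sub>R w i) = (\<Sum>i\<in>UNIV. w i - l i *\<^sub>R w i)"
        using d by (simp add: scaleR_sum_right scaleR_left_diff_distrib)
      then show ?thesis using l(2) by (simp add: \<phi>_def sum_subtractf)
    qed
    ultimately show "u \<in> \<phi> ` T" by blast
  qed
  ultimately have "convex hull V \<subseteq> \<phi> ` T" by (intro hull_minimal)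
  then have "measure lebesgue (convex hull V) \<le> measure lebesgue (\<phi> ` T)"
    using T fin
    by (intro measure_mono_fmeasurable fmeasurableD lmeasurable_compact finite_imp_compact_convex_hull)
  also have "\<dots> = d ^ CARD('n) * measure lebesgue T"
    unfolding \<phi>_def measure_lebesgue_affine using d by simp
  finally show ?thesis by (simp add: d_def T_def)
qed

text \<open>If the volume exceeded \<open>k\<close>, Blichfeldt's theorem would give
  \<open>k + 1\<close> lattice points \<open>z\<close> with \<open>x + z\<close> in the interior of
  \<open>T\<close>. The points \<open>y + (z - z0)\<close> would then be \<open>k + 1\<close>
  interior lattice points of \<open>P\<close>. A convex set has negligible frontier, so passing to
  the interior keeps the volume.\<close>

lemma measure_le_of_difference_subset:
  fixes T P :: "(real^'n) set"
  assumes T: "convex T" "bounded T" and P: "bounded P" and y: "lattice_point y"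
    and sub: "\<And>p q. p \<in> T \<Longrightarrow> q \<in> T \<Longrightarrow> y + p - q \<in> P"
  shows "measure lebesgue T \<le> real (num_interior_lattice_points P)"
proof (rule ccontr)
  define k where "k = num_interior_lattice_points P"
  assume "\<not> ?thesis"
  then have gt: "real k < measure lebesgue (interior T)"
    unfolding measure_interior[OF T(2) negligible_convex_frontier[OF T(1)]] k_def by simp
  obtain x Z where Z: "finite Z" "card Z = Suc k" "\<And>z. z \<in> Z \<Longrightarrow> lattice_point z"
    "\<And>z. z \<in> Z \<Longrightarrow> x + z \<in> interior T"
    using blichfeldt[OF lmeasurable_interior[OF T(2)] bounded_interior[OF T(2)] gt] by metis
  then obtain z0 where z0: "z0 \<in> Z" by fastforce
  define \<phi> where "\<phi> = (+) (y - (x + z0))"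
  have "\<phi> ` interior T \<subseteq> interior P"
  proof (rule interior_maximal)
    show "open (\<phi> ` interior T)" unfolding \<phi>_def by (intro open_translation open_interior)
    show "\<phi> ` interior T \<subseteq> P"
    proof safe
      fix p assume "p \<in> interior T"
      then have "y + p - (x + z0) \<in> P"
        using sub Z(4)[OF z0] interior_subset by blast
      then show "\<phi> p \<in> P" by (simp add: \<phi>_def algebra_simps)
    qed
  qed
  then have "(\<lambda>z. y + (z - z0)) ` Z \<subseteq> {x \<in> interior P. lattice_point x}"
    using Z(3,4) z0 y by (force simp: \<phi>_def algebra_simps intro!: lattice_point_intros)
  then have "card ((\<lambda>z. y + (z - z0)) ` Z) \<le> k"
    unfolding k_def num_interior_lattice_points_def
    using P by (intro card_mono finite_lattice_points_bounded bounded_interior)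
  moreover have "card ((\<lambda>z. y + (z - z0)) ` Z) = card Z"
    by (intro card_image) (simp add: inj_on_def)
  ultimately show False using Z(2) by simp
qed

lemma measure_lattice_polytope_le:
  fixes P :: "(real^'n) set"
  assumes P: "lattice_polytope P" and dim: "aff_dim P = int CARD('n)"
    and k: "num_interior_lattice_points P \<ge> 1"
  shows "measure lebesgue P \<le>
    (real CARD('n) * (2 * real CARD('n) + 1) * (real (sylvester (2 * CARD('n) + 1)) - 1)) ^ CARD('n)
      * real (num_interior_lattice_points P)"
proof -
  obtain V where V: "finite V" "V \<noteq> {}" "\<And>v. v \<in> V \<Longrightarrow> lattice_point v" and PV: "P = convex hull V"
    using P by (auto simp: lattice_polytope_def)
  have conv: "convex P" and bd: "bounded P"
    using V(1) by (auto simp: PV finite_imp_bounded_convex_hull)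
  have "aff_dim V = int CARD('n)" using dim by (simp add: PV aff_dim_convex_hull)
  then obtain w :: "'n option \<Rightarrow> real^'n" where w: "\<And>i. w i \<in> V"
    and l: "\<And>u. u \<in> V \<Longrightarrow> \<exists>l. (\<Sum>i\<in>UNIV. l i) = 1 \<and> (\<Sum>i\<in>UNIV. l i *\<^sub>R w i) = u \<and> (\<forall>i. l i \<le> 1)"
    using ex_max_simplex[OF V(1,2)] by blast
  define T where "T = convex hull (range w)"
  have vol: "measure lebesgue P \<le> real CARD('n) ^ CARD('n) * measure lebesgue T"
    unfolding PV T_def by (rule measure_convex_hull_le_simplex[OF V(1) l])
  have "{x \<in> interior P. lattice_point x} \<noteq> {}"
    using k unfolding num_interior_lattice_points_def by (metis card.empty not_one_le_zero)
  then obtain y0 where y0: "y0 \<in> interior (convex hull V)" "lattice_point y0"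
    unfolding PV by blast
  obtain f :: "'n option + 'n \<Rightarrow> real^'n" and \<beta>0 where f: "\<forall>i. f (Inl i) = w i" "\<forall>i. f i \<in> V"
    and \<beta>0: "\<forall>i. 0 < \<beta>0 i" "(\<Sum>i\<in>UNIV. \<beta>0 i) = 1" "(\<Sum>i\<in>UNIV. \<beta>0 i *\<^sub>R f i) = y0"
    by (rule ex_positive_combination[OF V(1) w y0(1)])
  have card: "CARD('n option + 'n) = 2 * CARD('n) + 1" by simp
  \<comment> \<open>With \<open>N = 2 d + 1\<close> indices, \<open>1 / M\<close> is the guaranteed
    lower bound for the coefficients and serves as the scaling factor of \<open>T\<close>.\<close>
  define M where "M = (2 * real CARD('n) + 1) * (real (sylvester (2 * CARD('n) + 1)) - 1)"
  have M: "M > 0" using sylvester_gt_1[of "2 * CARD('n)"] by (simp add: M_def)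
  have M_eq: "real CARD('n option + 'n) * (real (sylvester CARD('n option + 'n)) - 1) = M"
    unfolding card M_def by simp
  obtain \<beta> where \<beta>: "\<And>i. 1 / M \<le> \<beta> i" "(\<Sum>i\<in>UNIV. \<beta> i) = 1" "lattice_point (\<Sum>i\<in>UNIV. \<beta> i *\<^sub>R f i)"
    using ex_large_coefficients[of f \<beta>0] V(3) f(2) \<beta>0 y0(2) unfolding M_eq by blast
  have fP: "f i \<in> P" for i using f(2) by (simp add: PV hull_inc)
  have range: "range w = range (\<lambda>i. f (Inl i))" by (simp add: f(1))
  \<comment> \<open>The summand \<open>0\<close> gives the map the affine form treated by
    \<open>measure_lebesgue_affine\<close>.\<close>
  define T' where "T' = (\<lambda>x. (1 / M) *\<^sub>R x + 0) ` T"
  have "measure lebesgue T' \<le> real (num_interior_lattice_points P)"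
  proof (rule measure_le_of_difference_subset[OF _ _ bd \<beta>(3)])
    have "convex T" "bounded T"
      by (auto simp: T_def finite_imp_bounded_convex_hull)
    then show "convex T'" "bounded T'"
      by (auto simp: T'_def intro: convex_scaling bounded_scaling)
    fix p q assume "p \<in> T'" "q \<in> T'"
    then obtain p' q' where "p' \<in> T" "q' \<in> T" "p = (1 / M) *\<^sub>R p'" "q = (1 / M) *\<^sub>R q'"
      by (auto simp: T'_def)
    then show "(\<Sum>i\<in>UNIV. \<beta> i *\<^sub>R f i) + p - q \<in> P"
      using translated_difference_subset[OF \<beta>(1,2) _ conv fP, where w = Inl and p = p' and q = q'] M
      by (simp add: T_def range)
  qed
  also have "measure lebesgue T' = measure lebesgue T / M ^ CARD('n)"
    unfolding T'_def measure_lebesgue_affine using M by (simp add: power_divide)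
  finally have "measure lebesgue T \<le> M ^ CARD('n) * real (num_interior_lattice_points P)"
    using M by (simp add: pos_divide_le_eq mult.commute)
  then have "real CARD('n) ^ CARD('n) * measure lebesgue T \<le>
      real CARD('n) ^ CARD('n) * (M ^ CARD('n) * real (num_interior_lattice_points P))"
    by (intro mult_left_mono) auto
  then have "measure lebesgue P \<le> real CARD('n) ^ CARD('n) * (M ^ CARD('n) * real (num_interior_lattice_points P))"
    using vol by linarith
  then show ?thesis
    by (simp add: M_def power_mult_distrib mult.assoc)
qed

theorem theorem1p4:
  fixes k :: nat
  assumes "k \<ge> 1"
  shows
   "(\<forall>V :: (real ^ 'n) set.
        (\<forall>v\<in>V. lattice_point v) \<and> \<not> affine_dependent V \<and> card V = CARD('n) + 1 \<and>
        num_interior_lattice_points (convex hull V) = k \<longrightarrow>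
        (\<exists>x \<beta>. x \<in> interior (convex hull V) \<and> lattice_point x \<and>
           barycentric_coords V \<beta> x \<and>
           (\<forall>v\<in>V. \<beta> v \<ge> 1 / (real (CARD('n) + 1) * (real (sylvester (CARD('n) + 1)) - 1)))))
    \<and> (\<forall>P :: (real ^ 'n) set.
        lattice_polytope P \<and> aff_dim P = int CARD('n) \<and> num_interior_lattice_points P = k \<longrightarrow>
        measure lebesgue P \<le>
          (real CARD('n) * (2 * real CARD('n) + 1) * (real (sylvester (2 * CARD('n) + 1)) - 1))
            ^ CARD('n) * real k)"
proof (intro conjI allI impI)
  fix V :: "(real ^ 'n) set"
  assume "(\<forall>v\<in>V. lattice_point v) \<and> \<not> affine_dependent V \<and> card V = CARD('n) + 1 \<and>
    num_interior_lattice_points (convex hull V) = k"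
  then show "\<exists>x \<beta>. x \<in> interior (convex hull V) \<and> lattice_point x \<and> barycentric_coords V \<beta> x \<and>
      (\<forall>v\<in>V. \<beta> v \<ge> 1 / (real (CARD('n) + 1) * (real (sylvester (CARD('n) + 1)) - 1)))"
    using assms by (intro simplex_ex_large_barycentric_coords) auto
next
  fix P :: "(real ^ 'n) set"
  assume "lattice_polytope P \<and> aff_dim P = int CARD('n) \<and> num_interior_lattice_points P = k"
  then show "measure lebesgue P \<le>
      (real CARD('n) * (2 * real CARD('n) + 1) * (real (sylvester (2 * CARD('n) + 1)) - 1)) ^ CARD('n) * real k"
    using measure_lattice_polytope_le[of P] assms by simp
qed

end
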